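(* Let $n,L$ be positive integers. Every balanced temporal biclique of size $n$ and lifetime at most $L$ admits a temporal $3$-bispanner of size (number of edges) at most $12Ln$, computable in time $\mathcal{O}(Ln^3)$.
   Context: A temporal biclique $G=(S,T,\lambda)$ consists of disjoint finite sets $S$ (sources) and $T$ (targets) and a labeling $\lambda\colon E(G)\to\mathbb{N}$ assigning one positive integer time label to each edge, where the (undirected) edge set is $E(G)=\{\{s,t\}:s\in S,t\in T\}$. It is balanced of size $n$ if $|S|=|T|=n$. It has lifetime at most $L$ if all labels belong to $\{1,\dots,L\}$. A temporal path from $u$ to $v$ is a $u$-$v$-path whose edge labels, in order of traversal from $u$ to $v$, are nondecreasing; its length (number of hops) is its number of edges. A temporal $\alpha$-bispanner of $G$ is a set $E'\subseteq E(G)$ such that for every $s\in S$ and $t\in T$ there is a temporal path from $s$ to $t$ with at most $\alpha$ hops using only edges in $E'$ (paths from targets to sources are not required). Its size is $|E'|$. *)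

theory Defs
  imports Main
begin

section \<open>Temporal bicliques and bispanners\<close>

definition biclique_edges :: "'a set \<Rightarrow> 'a set \<Rightarrow> 'a set set" where
  "biclique_edges S T = {{s, t} | s t. s \<in> S \<and> t \<in> T}"

text \<open>Only the values of the labeling on the edges of the biclique are meaningful.\<close>

definition temporal_biclique :: "'a set \<Rightarrow> 'a set \<Rightarrow> ('a set \<Rightarrow> nat) \<Rightarrow> bool" where
  "temporal_biclique S T lam \<longleftrightarrow>
     finite S \<and> finite T \<and> S \<inter> T = {} \<and> (\<forall>e \<in> biclique_edges S T. 0 < lam e)"

definition balanced_of_size :: "'a set \<Rightarrow> 'a set \<Rightarrow> nat \<Rightarrow> bool" where
  "balanced_of_size S T n \<longleftrightarrow> card S = n \<and> card T = n"

definition lifetime_at_most :: "'a set \<Rightarrow> 'a set \<Rightarrow> ('a set \<Rightarrow> nat) \<Rightarrow> nat \<Rightarrow> bool" where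
  "lifetime_at_most S T lam L \<longleftrightarrow> (\<forall>e \<in> biclique_edges S T. lam e \<in> {1..L})"

text \<open>A path is given by its list of vertices.\<close>

fun path_edges :: "'a list \<Rightarrow> 'a set list" where
  "path_edges (u # v # p) = {u, v} # path_edges (v # p)"
| "path_edges _ = []"

definition temporal_path ::
  "('a set \<Rightarrow> nat) \<Rightarrow> 'a set set \<Rightarrow> 'a \<Rightarrow> 'a list \<Rightarrow> 'a \<Rightarrow> bool" where
  "temporal_path lam E' u p v \<longleftrightarrow>
     p \<noteq> [] \<and> hd p = u \<and> last p = v \<and> distinct p \<and>
     set (path_edges p) \<subseteq> E' \<and> sorted (map lam (path_edges p))"

definition hops :: "'a list \<Rightarrow> nat" where
  "hops p = length (path_edges p)"

definition temporal_bispanner ::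
  "'a set \<Rightarrow> 'a set \<Rightarrow> ('a set \<Rightarrow> nat) \<Rightarrow> nat \<Rightarrow> 'a set set \<Rightarrow> bool" where
  "temporal_bispanner S T lam \<alpha> E' \<longleftrightarrow>
     E' \<subseteq> biclique_edges S T \<and>
     (\<forall>s \<in> S. \<forall>t \<in> T. \<exists>p. temporal_path lam E' s p t \<and> hops p \<le> \<alpha>)"


section \<open>A word RAM with structured programs\<close>

text \<open>
  Running times refer to a word RAM, programmed in a while-language with natural-number arrays.
  Every variable is an (unbounded) array; a scalar is stored in cell 0 of its array.
  All values occurring in a run, including addresses and intermediate results, must not
  exceed a bound \<open>W\<close>, i.e. they must fit into machine words of about \<open>log W\<close> bits; a computation
  that would exceed \<open>W\<close> is stuck.
\<close>

type_synonym vname = string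
type_synonym state = "vname \<Rightarrow> nat \<Rightarrow> nat"

datatype aexp =
  Const nat | Cell vname aexp | Plus aexp aexp | Minus aexp aexp | Times aexp aexp

datatype bexp = Less aexp aexp | BNot bexp | BAnd bexp bexp

datatype com =
  Skip
| Assign vname aexp aexp
| Seq com com
| Cond bexp com com
| While bexp com

fun aval :: "aexp \<Rightarrow> state \<Rightarrow> nat" where
  "aval (Const k) s = k"
| "aval (Cell x a) s = s x (aval a s)"
| "aval (Plus a b) s = aval a s + aval b s"
| "aval (Minus a b) s = aval a s - aval b s"
| "aval (Times a b) s = aval a s * aval b s"

fun bval :: "bexp \<Rightarrow> state \<Rightarrow> bool" where
  "bval (Less a b) s = (aval a s < aval b s)"
| "bval (BNot b) s = (\<not> bval b s)"
| "bval (BAnd b c) s = (bval b s \<and> bval c s)"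

fun afits :: "nat \<Rightarrow> aexp \<Rightarrow> state \<Rightarrow> bool" where
  "afits W (Const k) s = (k \<le> W)"
| "afits W (Cell x a) s = (afits W a s \<and> s x (aval a s) \<le> W)"
| "afits W (Plus a b) s = (afits W a s \<and> afits W b s \<and> aval a s + aval b s \<le> W)"
| "afits W (Minus a b) s = (afits W a s \<and> afits W b s)"
| "afits W (Times a b) s = (afits W a s \<and> afits W b s \<and> aval a s * aval b s \<le> W)"

fun bfits :: "nat \<Rightarrow> bexp \<Rightarrow> state \<Rightarrow> bool" where
  "bfits W (Less a b) s = (afits W a s \<and> afits W b s)"
| "bfits W (BNot b) s = bfits W b s"
| "bfits W (BAnd b c) s = (bfits W b s \<and> bfits W c s)"

text \<open>Evaluation costs one time unit per constant, memory access and operation.\<close>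

fun acost :: "aexp \<Rightarrow> nat" where
  "acost (Const k) = 1"
| "acost (Cell x a) = 1 + acost a"
| "acost (Plus a b) = 1 + acost a + acost b"
| "acost (Minus a b) = 1 + acost a + acost b"
| "acost (Times a b) = 1 + acost a + acost b"

fun bcost :: "bexp \<Rightarrow> nat" where
  "bcost (Less a b) = 1 + acost a + acost b"
| "bcost (BNot b) = 1 + bcost b"
| "bcost (BAnd b c) = 1 + bcost b + bcost c"

text \<open>
  \<open>exec W c s m s'\<close>: with word bound \<open>W\<close>, program \<open>c\<close> started in state \<open>s\<close> halts after \<open>m\<close> time
  units in state \<open>s'\<close>. In \<open>Assign x a e\<close>, cell \<open>a\<close> of array \<open>x\<close> receives the value of \<open>e\<close>.
\<close>

inductive exec :: "nat \<Rightarrow> com \<Rightarrow> state \<Rightarrow> nat \<Rightarrow> state \<Rightarrow> bool" for W :: nat where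
  exec_Skip: "exec W Skip s 1 s"
| exec_Assign: "afits W a s \<Longrightarrow> afits W e s \<Longrightarrow>
    exec W (Assign x a e) s (1 + acost a + acost e) (s(x := (s x)(aval a s := aval e s)))"
| exec_Seq: "exec W c1 s m1 s1 \<Longrightarrow> exec W c2 s1 m2 s2 \<Longrightarrow>
    exec W (Seq c1 c2) s (m1 + m2) s2"
| exec_CondTrue: "bfits W b s \<Longrightarrow> bval b s \<Longrightarrow> exec W c1 s m s1 \<Longrightarrow>
    exec W (Cond b c1 c2) s (1 + bcost b + m) s1"
| exec_CondFalse: "bfits W b s \<Longrightarrow> \<not> bval b s \<Longrightarrow> exec W c2 s m s1 \<Longrightarrow>
    exec W (Cond b c1 c2) s (1 + bcost b + m) s1"
| exec_WhileFalse: "bfits W b s \<Longrightarrow> \<not> bval b s \<Longrightarrow>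
    exec W (While b c) s (1 + bcost b) s"
| exec_WhileTrue: "bfits W b s \<Longrightarrow> bval b s \<Longrightarrow> exec W c s m1 s1 \<Longrightarrow>
    exec W (While b c) s1 m2 s2 \<Longrightarrow>
    exec W (While b c) s (1 + bcost b + m1 + m2) s2"

inductive_cases exec_SkipE: "exec W Skip s m s'"
inductive_cases exec_AssignE: "exec W (Assign x a e) s m s'"
inductive_cases exec_SeqE: "exec W (Seq c1 c2) s m s'"
inductive_cases exec_CondE: "exec W (Cond b c1 c2) s m s'"
inductive_cases exec_WhileE: "exec W (While b c) s m s'"

text \<open>Runs are deterministic, so one terminating run determines the outcome and the running time.\<close>

lemma exec_deterministic:
  "exec W c s m s' \<Longrightarrow> exec W c s k s'' \<Longrightarrow> m = k \<and> s' = s''"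
proof (induction arbitrary: k s'' rule: exec.induct)
  case (exec_Skip s)
  then show ?case by (auto elim: exec_SkipE)
next
  case (exec_Assign a s e x)
  from exec_Assign.prems show ?case by (auto elim: exec_AssignE)
next
  case (exec_Seq c1 s m1 s1 c2 m2 s2)
  from exec_Seq.prems obtain k1 t1 k2 where
    "exec W c1 s k1 t1" "exec W c2 t1 k2 s''" "k = k1 + k2"
    by (rule exec_SeqE)
  with exec_Seq.IH show ?case by blast
next
  case (exec_CondTrue b s c1 m s1 c2)
  from exec_CondTrue.prems exec_CondTrue.hyps obtain k1 where
    "exec W c1 s k1 s''" "k = 1 + bcost b + k1"
    by (auto elim: exec_CondE)
  with exec_CondTrue.IH show ?case by simp
next
  case (exec_CondFalse b s c2 m s1 c1)
  from exec_CondFalse.prems exec_CondFalse.hyps obtain k1 where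
    "exec W c2 s k1 s''" "k = 1 + bcost b + k1"
    by (auto elim: exec_CondE)
  with exec_CondFalse.IH show ?case by simp
next
  case (exec_WhileFalse b s c)
  from exec_WhileFalse.prems show ?case
    by (rule exec_WhileE) (use exec_WhileFalse.hyps in simp_all)
next
  case (exec_WhileTrue b s c m1 s1 m2 s2)
  from exec_WhileTrue.prems obtain k1 t1 k2 where
    "exec W c s k1 t1" "exec W (While b c) t1 k2 s''" "k = 1 + bcost b + k1 + k2"
    by (rule exec_WhileE) (use exec_WhileTrue.hyps in simp_all)
  with exec_WhileTrue.IH show ?case by blast
qed


section \<open>Input and output of a bispanner algorithm\<close>

text \<open>
  The vertices are presented to the algorithm through enumerations \<open>us\<close> of the sources and \<open>ts\<close>
  of the targets. The input consists of the number \<open>n\<close> of sources and of the label matrix in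
  row-major order (row \<open>i\<close> for source \<open>us ! i\<close>, column \<open>j\<close> for target \<open>ts ! j\<close>); all other memory
  is zero. The output is the row-major incidence matrix of the edge set, nonzero meaning
  membership.
\<close>

definition input_state :: "('a set \<Rightarrow> nat) \<Rightarrow> 'a list \<Rightarrow> 'a list \<Rightarrow> state" where
  "input_state lam us ts = (\<lambda>x k.
     if x = ''n'' \<and> k = 0 then length us
     else if x = ''lab'' \<and> k < length us * length ts
       then lam {us ! (k div length ts), ts ! (k mod length ts)}
     else 0)"

definition output_edges :: "'a list \<Rightarrow> 'a list \<Rightarrow> state \<Rightarrow> 'a set set" where
  "output_edges us ts s =
     {{us ! i, ts ! j} | i j. i < length us \<and> j < length ts \<and> s ''out'' (i * length ts + j) \<noteq> 0}"

end

theory Submission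
  imports Defs
begin

text \<open>
  Fix a target \<open>h\<close> as a hub. A source \<open>i\<close> reaches a target \<open>j\<close> through the hub if some source \<open>w\<close>
  satisfies \<open>lam i h \<le> lam w h \<le> lam w j\<close>, and taking for every \<open>j\<close> the \<open>w\<close> with \<open>lam w h\<close>
  maximal serves all these pairs with a star at \<open>h\<close> and one further edge per target. Some hub
  connects at least a fraction \<open>1 / L\<close> of the sources to all targets: otherwise every hub \<open>h\<close> has a
  target \<open>h'\<close> with \<open>lam i h' < lam i h\<close> for all but fewer than a fraction \<open>1 / L\<close> of the sources
  \<open>i\<close>, and iterating \<open>L\<close> times from any hub leaves a source with \<open>L + 1\<close> different labels.

  So, with \<open>p\<close> sources and \<open>q\<close> targets, \<open>p + q\<close> edges suffice to dispose of \<open>p / L\<close> sources.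
  Reversing paths and complementing labels, the same number of edges disposes of \<open>q / L\<close>
  targets. Alternating the two, at most \<open>2 L\<close> edges are charged to each removed vertex, which gives
  \<open>4 L n\<close> edges in total. A round takes time proportional to \<open>n\<^sup>2\<close> times the number of remaining
  rows, and the same amortization bounds the running time.
\<close>

section \<open>Program logic\<close>

text \<open>Total correctness with a clock: the postcondition also receives the running time, and a
  program that diverges or gets stuck on the word bound satisfies no \<open>wp\<close>.\<close>

definition wp :: "nat \<Rightarrow> com \<Rightarrow> (nat \<Rightarrow> state \<Rightarrow> bool) \<Rightarrow> state \<Rightarrow> bool" where
  "wp W c Q s \<longleftrightarrow> (\<exists>m s'. exec W c s m s' \<and> Q m s')"

fun written :: "com \<Rightarrow> vname set" where
  "written Skip = {}"
| "written (Assign x a e) = {x}"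
| "written (Seq c1 c2) = written c1 \<union> written c2"
| "written (Cond b c1 c2) = written c1 \<union> written c2"
| "written (While b c) = written c"

lemma exec_not_written: "exec W c s m s' \<Longrightarrow> y \<notin> written c \<Longrightarrow> s' y = s y"
  by (induction rule: exec.induct) auto

lemma wp_mono: "wp W c Q s \<Longrightarrow> (\<And>m s'. Q m s' \<Longrightarrow> Q' m s') \<Longrightarrow> wp W c Q' s"
  unfolding wp_def by blast

text \<open>Frame rule: arrays outside \<open>written c\<close> survive as a whole, so the
  specification of a program part mentions only what it modifies.\<close>

lemma wp_frame:
  "wp W c Q s \<Longrightarrow> (\<And>m s'. Q m s' \<Longrightarrow> (\<And>y. y \<notin> written c \<Longrightarrow> s' y = s y) \<Longrightarrow> Q' m s') \<Longrightarrow> wp W c Q' s"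
  unfolding wp_def using exec_not_written by meson

lemma wp_Skip [simp]: "wp W Skip Q s \<longleftrightarrow> Q 1 s"
proof -
  have "exec W Skip s m s' \<longleftrightarrow> m = 1 \<and> s' = s" for m s'
    by (metis exec_Skip exec_SkipE)
  then show ?thesis unfolding wp_def by simp
qed

lemma wp_Assign [simp]:
  "wp W (Assign x a e) Q s \<longleftrightarrow> afits W a s \<and> afits W e s \<and>
     Q (1 + acost a + acost e) (s(x := (s x)(aval a s := aval e s)))"
proof -
  have "exec W (Assign x a e) s m s' \<longleftrightarrow> afits W a s \<and> afits W e s \<and>
      m = 1 + acost a + acost e \<and> s' = s(x := (s x)(aval a s := aval e s))" for m s'
    by (metis exec_Assign exec_AssignE)
  then show ?thesis unfolding wp_def by simp
qed

lemma wp_Seq [simp]: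
  "wp W (Seq c1 c2) Q s \<longleftrightarrow> wp W c1 (\<lambda>m1. wp W c2 (\<lambda>m2. Q (m1 + m2))) s"
  unfolding wp_def by (metis exec_Seq exec_SeqE)

lemma wp_Cond:
  "wp W (Cond b c1 c2) Q s \<longleftrightarrow> bfits W b s \<and>
     (if bval b s then wp W c1 (\<lambda>m. Q (1 + bcost b + m)) s
      else wp W c2 (\<lambda>m. Q (1 + bcost b + m)) s)"
proof -
  have "exec W (Cond b c1 c2) s m s' \<longleftrightarrow> bfits W b s \<and>
      (\<exists>k. m = 1 + bcost b + k \<and> exec W (if bval b s then c1 else c2) s k s')" for m s'
    by (rule iffI, erule exec_CondE) (auto simp del: One_nat_def plus_1_eq_Suc add_Suc
        intro: exec_CondTrue exec_CondFalse split: if_splits)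
  then show ?thesis unfolding wp_def by auto
qed

definition IF :: "bexp \<Rightarrow> com \<Rightarrow> com" where
  "IF b c = Cond b c Skip"

lemma written_IF [simp]: "written (IF b c) = written c"
  by (simp add: IF_def)

lemma wp_IF [simp]:
  "wp W (IF b c) Q s \<longleftrightarrow> bfits W b s \<and>
     (if bval b s then wp W c (\<lambda>m. Q (1 + bcost b + m)) s else Q (2 + bcost b) s)"
  by (simp add: IF_def wp_Cond)

abbreviation sc :: "vname \<Rightarrow> aexp" where
  "sc x \<equiv> Cell x (Const 0)"

definition FOR :: "vname \<Rightarrow> com \<Rightarrow> com" where
  "FOR x c = Seq (Assign x (Const 0) (Const 0))
     (While (Less (sc x) (sc ''n'')) (Seq c (Assign x (Const 0) (Plus (sc x) (Const 1)))))"

lemma written_FOR [simp]: "written (FOR x c) = insert x (written c)"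
  by (simp add: FOR_def)

lemma wp_While_True:
  "bfits W b s \<Longrightarrow> bval b s \<Longrightarrow> wp W c (\<lambda>m1. wp W (While b c) (\<lambda>m2. Q (1 + bcost b + m1 + m2))) s
    \<Longrightarrow> wp W (While b c) Q s"
  unfolding wp_def by (meson exec_WhileTrue)

lemma wp_While_False:
  "bfits W b s \<Longrightarrow> \<not> bval b s \<Longrightarrow> Q (1 + bcost b) s \<Longrightarrow> wp W (While b c) Q s"
  unfolding wp_def by (meson exec_WhileFalse)

text \<open>In \<open>I k t s\<close>, \<open>k\<close> counts finished iterations and
  \<open>t\<close> is the time spent in the bodies alone; the state already has its counter at
  \<open>k\<close>. The overhead is 12 per iteration (6 for the test, 6 for the increment), 3 for
  the initial assignment and 6 for the last, failing test.\<close>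

lemma wp_FOR:
  fixes s :: state
  assumes "s ''n'' 0 = N" "N < W" "x \<noteq> ''n''" "x \<notin> written c" "''n'' \<notin> written c"
    and init: "I 0 0 (s(x := (s x)(0 := 0)))"
    and step: "\<And>k t s'. k < N \<Longrightarrow> I k t s' \<Longrightarrow> s' x 0 = k \<Longrightarrow>
      (\<And>y. y \<notin> insert x (written c) \<Longrightarrow> s' y = s y) \<Longrightarrow>
      wp W c (\<lambda>m s''. I (Suc k) (t + m) (s''(x := (s'' x)(0 := Suc k)))) s'"
    and fin: "\<And>t s'. I N t s' \<Longrightarrow> (\<And>y. y \<notin> insert x (written c) \<Longrightarrow> s' y = s y) \<Longrightarrow>
      Q (t + 12 * N + 9) s'"
  shows "wp W (FOR x c) Q s"
proof -
  let ?body = "Seq c (Assign x (Const 0) (Plus (sc x) (Const 1)))"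
  have loop: "wp W (While (Less (sc x) (sc ''n'')) ?body) (\<lambda>m s''. Q (t + 12 * k + 3 + m) s'') s'"
    if "k \<le> N" "I k t s'" "s' x 0 = k" "\<And>y. y \<notin> insert x (written c) \<Longrightarrow> s' y = s y" for k t s'
    using that
  proof (induction "N - k" arbitrary: k t s')
    case 0
    then have "k = N" by simp
    moreover have n: "s' ''n'' 0 = N" using 0 assms by auto
    ultimately show ?case
      using 0 assms fin[of t s'] by (intro wp_While_False) (auto simp: algebra_simps)
  next
    case (Suc d)
    then have k: "k < N" by simp
    have n: "s' ''n'' 0 = N" using Suc.prems assms by auto
    show ?case
    proof (rule wp_While_True)
      show "bfits W (Less (sc x) (sc ''n'')) s'" "bval (Less (sc x) (sc ''n'')) s'"
        using n k Suc.prems assms by auto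
      have 1: "wp W c (\<lambda>m s''. I (Suc k) (t + m) (s''(x := (s'' x)(0 := Suc k)))) s'"
        using step k Suc.prems by blast
      show "wp W ?body (\<lambda>m1. wp W (While (Less (sc x) (sc ''n'')) ?body)
          (\<lambda>m2. Q (t + 12 * k + 3 + (1 + bcost (Less (sc x) (sc ''n'')) + m1 + m2)))) s'"
        unfolding wp_Seq
      proof (rule wp_frame[OF 1])
        fix m s''
        assume I: "I (Suc k) (t + m) (s''(x := (s'' x)(0 := Suc k)))"
          and fr: "\<And>y. y \<notin> written c \<Longrightarrow> s'' y = s' y"
        have x: "s'' x 0 = k" using fr assms Suc.prems by auto
        show "wp W (Assign x (Const 0) (Plus (sc x) (Const 1)))
            (\<lambda>m2. wp W (While (Less (sc x) (sc ''n'')) ?body)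
               (\<lambda>m2a. Q (t + 12 * k + 3 + (1 + bcost (Less (sc x) (sc ''n'')) + (m + m2) + m2a)))) s''"
          using Suc.hyps(1)[of "Suc k" "t + m" "s''(x := (s'' x)(0 := Suc k))"] I x k assms
            Suc.hyps(2) Suc.prems fr
          by (auto simp: algebra_simps)
      qed
    qed
  qed
  show ?thesis
    unfolding FOR_def wp_Seq
    using loop[of 0 0 "s(x := (s x)(0 := 0))"] init assms by (simp add: numeral_eq_Suc)
qed

text \<open>The 21 is the 12 per iteration plus the fixed 9, absorbed into the factor
  \<open>N\<close> since \<open>0 < N\<close>.\<close>

lemma wp_FOR_const:
  fixes s :: state
  assumes "s ''n'' 0 = N" "N < W" "0 < N" "x \<noteq> ''n''" "x \<notin> written c" "''n'' \<notin> written c"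
    and init: "I 0 (s(x := (s x)(0 := 0)))"
    and step: "\<And>k s'. k < N \<Longrightarrow> I k s' \<Longrightarrow> s' x 0 = k \<Longrightarrow>
      (\<And>y. y \<notin> insert x (written c) \<Longrightarrow> s' y = s y) \<Longrightarrow>
      wp W c (\<lambda>m s''. m \<le> C \<and> I (Suc k) (s''(x := (s'' x)(0 := Suc k)))) s'"
  shows "wp W (FOR x c) (\<lambda>m s'. m \<le> (C + 21) * N \<and> I N s') s"
proof (rule wp_FOR[where I = "\<lambda>k t s'. t \<le> C * k \<and> I k s'" and N = N])
  fix k t s'
  assume "k < N" "t \<le> C * k \<and> I k s'" "s' x 0 = k"
    "\<And>y. y \<notin> insert x (written c) \<Longrightarrow> s' y = s y"
  then show "wp W c (\<lambda>m s''. t + m \<le> C * Suc k \<and> I (Suc k) (s''(x := (s'' x)(0 := Suc k)))) s'"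
    using step[of k s'] by (auto elim!: wp_mono)
next
  fix t s'
  assume "t \<le> C * N \<and> I N s'"
  then show "t + 12 * N + 9 \<le> (C + 21) * N \<and> I N s'"
    using \<open>0 < N\<close> by (auto simp: algebra_simps)
qed (use assms in auto)

section \<open>One round of the reduction\<close>

text \<open>
  For a column \<open>h\<close> used as a hub, \<open>best lam R h j\<close> is one more than the largest label \<open>lam w h\<close> of
  a row \<open>w\<close> through which the hub can be left towards column \<open>j\<close>; it is 0 if there is none. So a
  row \<open>i\<close> with \<open>lam i h < worst lam mx R Q h\<close> can reach every column in \<open>Q\<close> through the hub.
\<close>

definition best :: "(nat \<Rightarrow> nat \<Rightarrow> nat) \<Rightarrow> nat set \<Rightarrow> nat \<Rightarrow> nat \<Rightarrow> nat" where
  "best lam R h j = Max (insert 0 ((\<lambda>i. Suc (lam i h)) ` {i \<in> R. lam i h \<le> lam i j}))"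

definition worst :: "(nat \<Rightarrow> nat \<Rightarrow> nat) \<Rightarrow> nat \<Rightarrow> nat set \<Rightarrow> nat set \<Rightarrow> nat \<Rightarrow> nat" where
  "worst lam mx R Q h = Min (insert (Suc mx) (best lam R h ` Q))"

lemma best_empty [simp]: "best lam {} h j = 0"
  by (simp add: best_def)

lemma best_insert:
  assumes "finite R"
  shows "best lam (insert k R) h j =
    (if lam k h \<le> lam k j then max (Suc (lam k h)) (best lam R h j) else best lam R h j)"
proof -
  have "{i \<in> insert k R. lam i h \<le> lam i j} =
      (if lam k h \<le> lam k j then insert k {i \<in> R. lam i h \<le> lam i j} else {i \<in> R. lam i h \<le> lam i j})"
    by auto
  then have "best lam (insert k R) h j = Max (if lam k h \<le> lam k j
      then insert (Suc (lam k h)) (insert 0 ((\<lambda>i. Suc (lam i h)) ` {i \<in> R. lam i h \<le> lam i j}))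
      else insert 0 ((\<lambda>i. Suc (lam i h)) ` {i \<in> R. lam i h \<le> lam i j}))"
    by (auto simp: best_def intro: arg_cong[of _ _ Max])
  then show ?thesis
    using assms by (auto simp: best_def simp del: Max_insert intro!: Max_insert)
qed

lemma best_ge: "finite R \<Longrightarrow> i \<in> R \<Longrightarrow> lam i h \<le> lam i j \<Longrightarrow> lam i h < best lam R h j"
  unfolding best_def by (rule Suc_le_lessD, rule Max_ge) auto

lemma worst_empty [simp]: "worst lam mx R {} h = Suc mx"
  by (simp add: worst_def)

lemma worst_insert:
  "finite Q \<Longrightarrow> worst lam mx R (insert j Q) h = min (best lam R h j) (worst lam mx R Q h)"
  unfolding worst_def image_insert by (subst insert_commute, rule Min_insert) auto

lemma worst_le: "finite Q \<Longrightarrow> j \<in> Q \<Longrightarrow> worst lam mx R Q h \<le> best lam R h j"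
  unfolding worst_def by (rule Min_le) auto

lemma worst_le_mx: "finite Q \<Longrightarrow> worst lam mx R Q h \<le> Suc mx"
  unfolding worst_def by (rule Min_le) auto

lemma worst_cases:
  assumes "finite Q"
  obtains "worst lam mx R Q h = Suc mx" | j where "j \<in> Q" "worst lam mx R Q h = best lam R h j"
proof -
  have "worst lam mx R Q h \<in> insert (Suc mx) (best lam R h ` Q)"
    unfolding worst_def using assms by (intro Min_in) auto
  then show ?thesis using that by auto
qed

section \<open>Existence of a good hub\<close>

text \<open>The hypothesis \<open>range\<close> bounds the spread of the labels within a row instead
  of the labels themselves, a form that complemented labels satisfy as well. The proof is the
  descent along bad hubs.\<close>

lemma good_hub:
  fixes lam :: "nat \<Rightarrow> nat \<Rightarrow> nat"
  assumes "finite R" "finite Q" "Q \<subseteq> {..<N}" "0 < N"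
    and le: "\<And>i h. i \<in> R \<Longrightarrow> h < N \<Longrightarrow> lam i h \<le> mx"
    and range: "\<And>i h h'. i \<in> R \<Longrightarrow> h < N \<Longrightarrow> h' < N \<Longrightarrow> lam i h < lam i h' + L"
  shows "\<exists>h<N. card R \<le> L * card {i \<in> R. lam i h < worst lam mx R Q h}"
proof (rule ccontr)
  let ?A = "\<lambda>h. {i \<in> R. lam i h < worst lam mx R Q h}"
  assume "\<not> ?thesis"
  then have bad: "L * card (?A h) < card R" if "h < N" for h
    using that by (meson not_le)
  have "R \<noteq> {}" using bad[OF \<open>0 < N\<close>] by auto
  then have "0 < L" using range \<open>0 < N\<close> by (metis all_not_in_conv less_add_same_cancel1)
  \<comment> \<open>The next column is one attaining the minimum in \<open>worst\<close>: a row
    \<open>i\<close> with \<open>lam i h \<le> lam i j\<close> would be its own witness and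
    therefore lie in \<open>?A h\<close>.\<close>
  have nxt: "\<exists>j<N. \<forall>i\<in>R - ?A h. lam i j < lam i h" if h: "h < N" for h
  proof (rule worst_cases[OF \<open>finite Q\<close>, of lam mx R h])
    \<comment> \<open>The default value exceeds every label, so all rows would be good, against
      \<open>bad\<close>.\<close>
    assume "worst lam mx R Q h = Suc mx"
    then have "?A h = R" using le h by (auto simp: less_Suc_eq_le)
    then have "L * card R < card R" using bad[OF h] by simp
    then show ?thesis using \<open>0 < L\<close> by (cases L) auto
  next
    fix j assume j: "j \<in> Q" "worst lam mx R Q h = best lam R h j"
    then have "\<forall>i\<in>R - ?A h. lam i j < lam i h"
      using best_ge[OF \<open>finite R\<close>, of _ lam h j] by (auto simp: not_less[symmetric])
    then show ?thesis using j assms by auto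
  qed
  \<comment> \<open>After \<open>D\<close> descents from column 0, a row whose label has not dropped
    by \<open>D\<close> was lost at some descent. By integrality, \<open>bad\<close> says that each
    descent loses at most \<open>card R - 1\<close> rows, counted with weight
    \<open>L\<close>.\<close>
  have "\<exists>h<N. L * card {i \<in> R. \<not> lam i h + D \<le> lam i 0} \<le> D * (card R - 1)" for D
  proof (induction D)
    case 0
    then show ?case using \<open>0 < N\<close> by (intro exI[of _ 0]) simp
  next
    case (Suc D)
    let ?B = "\<lambda>D h. {i \<in> R. \<not> lam i h + D \<le> lam i 0}"
    from Suc obtain h where h: "h < N" "L * card (?B D h) \<le> D * (card R - 1)" by blast
    obtain j where j: "j < N" "\<forall>i\<in>R - ?A h. lam i j < lam i h" using nxt h by blast
    have "?B (Suc D) j \<subseteq> ?B D h \<union> ?A h"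
    proof
      fix i assume "i \<in> ?B (Suc D) j"
      then show "i \<in> ?B D h \<union> ?A h" using j(2)[rule_format, of i] by (cases "i \<in> ?A h") auto
    qed
    then have "card (?B (Suc D) j) \<le> card (?B D h \<union> ?A h)"
      using \<open>finite R\<close> by (intro card_mono) auto
    also have "\<dots> \<le> card (?B D h) + card (?A h)" by (rule card_Un_le)
    finally have "L * card (?B (Suc D) j) \<le> L * (card (?B D h) + card (?A h))" by (rule mult_le_mono2)
    also have "\<dots> = L * card (?B D h) + L * card (?A h)" by (rule add_mult_distrib2)
    also have "\<dots> \<le> D * (card R - 1) + (card R - 1)" using h bad[OF h(1)] by simp
    finally show ?case using j by (intro exI[of _ j]) simp
  qed
  then obtain h where h: "h < N" "L * card {i \<in> R. \<not> lam i h + L \<le> lam i 0} \<le> L * (card R - 1)"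
    by blast
  \<comment> \<open>For \<open>D = L\<close> no row can have dropped that far, so all of
    \<open>R\<close> is lost, which exceeds the allowance.\<close>
  have "{i \<in> R. \<not> lam i h + L \<le> lam i 0} = R"
    using range[OF _ \<open>0 < N\<close> h(1)] by (auto simp: not_le)
  then have "card R \<le> card R - 1" using h \<open>0 < L\<close> by simp
  moreover have "0 < card R" using \<open>R \<noteq> {}\<close> \<open>finite R\<close> by (simp add: card_gt_0_iff)
  ultimately show False by simp
qed

section \<open>Set-level effect of a round\<close>

text \<open>The contract between program and counting argument: \<open>h\<close> is the hub,
  \<open>w j\<close> the witness for column \<open>j\<close>, and \<open>R - R'\<close> the removed
  rows. The witness conditions are tied to a removed row, because for empty \<open>R\<close> the
  witnesses are only default entries.\<close>

definition round_step ::
  "nat \<Rightarrow> nat \<Rightarrow> (nat \<Rightarrow> nat \<Rightarrow> nat) \<Rightarrow> nat set \<Rightarrow> nat set \<Rightarrow> (nat \<times> nat) set \<Rightarrow> nat set \<Rightarrow> (nat \<times> nat) set \<Rightarrow> bool"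
where
  "round_step N L lam R Q E R' E' \<longleftrightarrow>
    (\<exists>h w. h < N \<and> R' \<subseteq> R \<and> E' = E \<union> R \<times> {h} \<union> (\<lambda>j. (w j, j)) ` Q \<and>
      card R \<le> L * card (R - R') \<and>
      (\<forall>i\<in>R - R'. \<forall>j\<in>Q. w j < N \<and> lam i h \<le> lam (w j) h \<and> lam (w j) h \<le> lam (w j) j \<and> w j \<in> R))"

text \<open>The path \<open>i\<close>, \<open>h\<close>, \<open>w\<close>, \<open>j\<close> may
  degenerate to \<open>w = i\<close> or \<open>h = j\<close>; in both cases \<open>(i, j)\<close> is
  itself in \<open>E\<close>.\<close>

definition reach :: "(nat \<Rightarrow> nat \<Rightarrow> nat) \<Rightarrow> (nat \<times> nat) set \<Rightarrow> nat \<Rightarrow> nat \<Rightarrow> bool" where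
  "reach lam E i j \<longleftrightarrow> (\<exists>h w. (i, h) \<in> E \<and> (w, h) \<in> E \<and> (w, j) \<in> E \<and>
     lam i h \<le> lam w h \<and> lam w h \<le> lam w j)"

lemma reach_mono: "reach lam E i j \<Longrightarrow> E \<subseteq> E' \<Longrightarrow> reach lam E' i j"
  unfolding reach_def by blast

text \<open>Read backwards, the hub and the witness exchange their roles. The bound
  \<open>mx\<close> makes truncated subtraction order-reversing on the labels in question.\<close>

lemma reach_transpose:
  assumes "\<And>i j. (i, j) \<in> E \<Longrightarrow> lam i j \<le> mx"
  shows "reach (\<lambda>j i. mx - lam i j) (E\<inverse>) j i \<Longrightarrow> reach lam E i j"
  unfolding reach_def
proof (elim exE conjE)
  fix h w
  assume "(j, h) \<in> E\<inverse>" "(w, h) \<in> E\<inverse>" "(w, i) \<in> E\<inverse>"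
    "mx - lam h j \<le> mx - lam h w" "mx - lam h w \<le> mx - lam i w"
  moreover from this have "lam h j \<le> mx" "lam h w \<le> mx" "lam i w \<le> mx" using assms by auto
  ultimately show "\<exists>h w. (i, h) \<in> E \<and> (w, h) \<in> E \<and> (w, j) \<in> E \<and> lam i h \<le> lam w h \<and> lam w h \<le> lam w j"
    by (intro exI[of _ w] exI[of _ h]) auto
qed

lemma round_step_reach:
  "round_step N L lam R Q E R' E' \<Longrightarrow> i \<in> R - R' \<Longrightarrow> j \<in> Q \<Longrightarrow> reach lam E' i j"
  unfolding round_step_def reach_def by blast

lemma round_step_subset: "round_step N L lam R Q E R' E' \<Longrightarrow> E \<subseteq> E' \<and> R' \<subseteq> R"
  unfolding round_step_def by blast

lemma round_step_card:
  assumes "round_step N L lam R Q E R' E'" "finite R" "finite Q" "finite E"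
  shows "card E' \<le> card E + card R + card Q"
proof -
  obtain h w where E': "E' = E \<union> R \<times> {h} \<union> (\<lambda>j. (w j, j)) ` Q"
    using assms unfolding round_step_def by blast
  have "card E' \<le> card E + card (R \<times> {h}) + card ((\<lambda>j. (w j, j)) ` Q)"
    unfolding E' by (meson add_le_cancel_right card_Un_le le_trans)
  then show ?thesis using card_image_le[OF assms(3), of "\<lambda>j. (w j, j)"] by (simp add: card_cartesian_product)
qed

text \<open>The first inequality is the charging argument without subtraction: \<open>card R\<close>
  is paid for by \<open>L\<close> times the decrease of the row set. The second is the progress that
  bounds the number of iterations.\<close>

lemma round_step_removed:
  assumes "round_step N L lam R Q E R' E'" "finite R"
  shows "card R + L * card R' \<le> L * card R" "R \<noteq> {} \<Longrightarrow> card R' < card R"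
proof -
  have R: "R' \<subseteq> R" "card R \<le> L * card (R - R')" using assms unfolding round_step_def by blast+
  then have "card (R - R') = card R - card R'" "card R' \<le> card R"
    using assms(2) by (auto intro: card_Diff_subset finite_subset card_mono)
  then show "card R + L * card R' \<le> L * card R"
    using R by (metis add_mult_distrib2 add_le_mono1 le_add_diff_inverse2)
  assume "R \<noteq> {}"
  then have "0 < card (R - R')" using R assms(2) by (metis card_0_eq gr0I le_zero_eq mult_0_right)
  then show "card R' < card R" using \<open>card (R - R') = card R - card R'\<close> by simp
qed

section \<open>The program\<close>

text \<open>
  Both halves of an iteration are instances of the same code: for \<open>b = True\<close> the rows are the
  sources, for \<open>b = False\<close> the targets. In the second case matrices are read transposed, and the
  array \<open>neg\<close> of complemented labels replaces \<open>lab\<close>, since reversing a path reverses the order of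
  its labels.
\<close>

definition pos :: "nat \<Rightarrow> bool \<Rightarrow> nat \<Rightarrow> nat \<Rightarrow> nat" where
  "pos N b i j = (if b then i * N + j else j * N + i)"

definition ix :: "bool \<Rightarrow> aexp \<Rightarrow> aexp \<Rightarrow> aexp" where
  "ix b a c = (if b then Plus (Times a (sc ''n'')) c else Plus (Times c (sc ''n'')) a)"

definition lb :: "bool \<Rightarrow> vname" where
  "lb b = (if b then ''lab'' else ''neg'')"

definition lab :: "bool \<Rightarrow> aexp \<Rightarrow> aexp \<Rightarrow> aexp" where
  "lab b a c = Cell (lb b) (ix b a c)"

text \<open>An entry 0 marks a row (column) as still alive.\<close>

definition rr :: "bool \<Rightarrow> vname" where
  "rr b = (if b then ''row'' else ''col'')"

definition alive :: "bool \<Rightarrow> aexp \<Rightarrow> bexp" where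
  "alive b a = Less (Cell (rr b) a) (Const 1)"

definition set_sc :: "vname \<Rightarrow> aexp \<Rightarrow> com" where
  "set_sc x e = Assign x (Const 0) e"

text \<open>The tables \<open>bst\<close> and \<open>wit\<close> are indexed by hub and column in
  the same way in both halves; only labels, life marks and output depend on
  \<open>b\<close>.\<close>

definition reset :: com where
  "reset = FOR ''h'' (FOR ''j'' (Seq
     (Assign ''bst'' (ix True (sc ''h'') (sc ''j'')) (Const 0))
     (Assign ''wit'' (ix True (sc ''h'') (sc ''j'')) (Const 0))))"

text \<open>The update of \<open>best_insert\<close>. Since \<open>bst\<close> holds a label plus
  one, \<open>bst \<le> lam i h\<close> means that row \<open>i\<close> strictly improves the
  entry.\<close>

definition scan_body :: "bool \<Rightarrow> com" where
  "scan_body b = IF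
     (BAnd (BNot (Less (lab b (sc ''i'') (sc ''j'')) (lab b (sc ''i'') (sc ''h''))))
       (BNot (Less (lab b (sc ''i'') (sc ''h'')) (Cell ''bst'' (ix True (sc ''h'') (sc ''j''))))))
     (Seq
       (Assign ''bst'' (ix True (sc ''h'') (sc ''j'')) (Plus (lab b (sc ''i'') (sc ''h'')) (Const 1)))
       (Assign ''wit'' (ix True (sc ''h'') (sc ''j'')) (sc ''i'')))"

text \<open>The row loop is outermost, so that a dead row costs constant time; the amortization of
  the running time rests on this.\<close>

definition scan :: "bool \<Rightarrow> com" where
  "scan b = FOR ''i'' (IF (alive b (sc ''i'')) (FOR ''h'' (FOR ''j'' (scan_body b))))"

definition minimize :: "bool \<Rightarrow> com" where
  "minimize b = FOR ''j''
     (IF (BAnd (alive (\<not> b) (sc ''j'')) (Less (Cell ''bst'' (ix True (sc ''h'') (sc ''j''))) (sc ''m'')))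
       (set_sc ''m'' (Cell ''bst'' (ix True (sc ''h'') (sc ''j'')))))"

definition count :: "bool \<Rightarrow> com" where
  "count b = FOR ''i''
     (IF (BAnd (alive b (sc ''i'')) (Less (lab b (sc ''i'') (sc ''h'')) (sc ''m'')))
       (set_sc ''c'' (Plus (sc ''c'') (Const 1))))"

text \<open>Exhaustive search for the hub that disposes of the most rows. The initial threshold 0 in
  \<open>bm\<close> removes no row and agrees with the initial count 0.\<close>

definition select :: "bool \<Rightarrow> com" where
  "select b = Seq (set_sc ''bh'' (Const 0)) (Seq (set_sc ''bm'' (Const 0)) (Seq (set_sc ''bc'' (Const 0))
     (FOR ''h'' (Seq (set_sc ''m'' (Plus (sc ''mx'') (Const 1))) (Seq (minimize b)
       (Seq (set_sc ''c'' (Const 0)) (Seq (count b)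
         (IF (Less (sc ''bc'') (sc ''c''))
           (Seq (set_sc ''bc'' (sc ''c'')) (Seq (set_sc ''bm'' (sc ''m'')) (set_sc ''bh'' (sc ''h''))))))))))))"

definition mark_cols :: "bool \<Rightarrow> com" where
  "mark_cols b = FOR ''j'' (IF (alive (\<not> b) (sc ''j''))
     (Assign ''out'' (ix b (Cell ''wit'' (ix True (sc ''bh'') (sc ''j''))) (sc ''j'')) (Const 1)))"

definition mark_rows :: "bool \<Rightarrow> com" where
  "mark_rows b = FOR ''i'' (IF (alive b (sc ''i''))
     (Seq (Assign ''out'' (ix b (sc ''i'') (sc ''bh'')) (Const 1))
       (IF (Less (lab b (sc ''i'') (sc ''bh'')) (sc ''bm'')) (Assign (rr b) (sc ''i'') (Const 1)))))"

definition round :: "bool \<Rightarrow> com" where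
  "round b = Seq reset (Seq (scan b) (Seq (select b) (Seq (mark_cols b) (mark_rows b))))"

lemmas prog_defs = reset_def scan_body_def scan_def minimize_def count_def select_def
  mark_cols_def mark_rows_def round_def set_sc_def

lemma written_simps [simp]:
  "written (set_sc x e) = {x}"
  "written reset = {''h'', ''j'', ''bst'', ''wit''}"
  "written (scan_body b) = {''bst'', ''wit''}"
  "written (scan b) = {''i'', ''h'', ''j'', ''bst'', ''wit''}"
  "written (minimize b) = {''j'', ''m''}"
  "written (count b) = {''i'', ''c''}"
  "written (select b) = {''bh'', ''bm'', ''bc'', ''h'', ''m'', ''j'', ''c'', ''i''}"
  "written (mark_cols b) = {''j'', ''out''}"
  "written (mark_rows b) = {''i'', ''out'', rr b}"
  by (auto simp: prog_defs)

lemma var_neq [simp]: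
  "x \<in> {''n'', ''mx'', ''i'', ''j'', ''h'', ''k'', ''bst'', ''wit'', ''m'', ''c'', ''bc'', ''bh'', ''bm'', ''out''} \<Longrightarrow>
    lb b \<noteq> x \<and> x \<noteq> lb b \<and> rr b \<noteq> x \<and> x \<noteq> rr b"
  "lb b \<noteq> rr b'" "rr b' \<noteq> lb b" "rr b \<noteq> rr (\<not> b)" "rr (\<not> b) \<noteq> rr b"
  by (auto simp: lb_def rr_def)

lemma pos_less: "i < N \<Longrightarrow> j < N \<Longrightarrow> pos N b i j < N * N"
proof -
  have "a * N + c < N * N" if "a < N" "c < N" for a c
  proof -
    have "a * N + c < Suc a * N" using that by simp
    also have "\<dots> \<le> N * N" using that by (intro mult_le_mono1) simp
    finally show ?thesis .
  qed
  then show "i < N \<Longrightarrow> j < N \<Longrightarrow> ?thesis" by (simp add: pos_def)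
qed

lemma pos_eq [simp]:
  assumes "i < N" "j < N" "i' < N" "j' < N"
  shows "pos N b i j = pos N b i' j' \<longleftrightarrow> i = i' \<and> j = j'"
proof -
  have "a = a' \<and> c = c'" if "a * N + c = a' * N + c'" "c < N" "c' < N" for a c a' c'
  proof -
    have "(a * N + c) div N = a" "(a' * N + c') div N = a'" using that(2,3) by simp_all
    then have "a = a'" using that(1) by metis
    then show ?thesis using that(1) by simp
  qed
  note this[of i j i' j'] this[of j i j' i']
  then show ?thesis using assms unfolding pos_def by metis
qed

lemma wp_set_Seq:
  assumes "afits W e s" "acost e + 2 = a" "aval e s = v"
    and "wp W c (\<lambda>m. Q (a + m)) (s(x := (s x)(0 := v)))"
  shows "wp W (Seq (set_sc x e) c) Q s"
proof -
  have "1 + acost (Const 0) + acost e = a" using assms(2) by simp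
  then show ?thesis using assms unfolding set_sc_def wp_Seq wp_Assign by simp
qed

lemma aval_ix [simp]: "aval (ix b a c) s = pos (s ''n'' 0) b (aval a s) (aval c s)"
  by (simp add: ix_def pos_def)

lemma acost_ix [simp]: "acost (ix b a c) = acost a + acost c + 4"
  by (simp add: ix_def)

lemma acost_lab [simp]: "acost (lab b a c) = acost a + acost c + 5"
  by (simp add: lab_def)

section \<open>Correctness and running time of one round\<close>

text \<open>\<open>lam\<close> is the matrix as seen by the current half, transposed and
  complemented when \<open>b\<close> is false. \<open>W\<close> leaves room for addresses below
  \<open>N * N\<close>, counters up to \<open>N\<close> and the shifted labels up to
  \<open>mx + 1\<close>.\<close>

locale round_context =
  fixes W N mx L :: nat and lam :: "nat \<Rightarrow> nat \<Rightarrow> nat" and b :: bool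
  assumes N: "0 < N" and W: "N * N + N + mx + 5 \<le> W"
    and lam_le: "\<And>i j. i < N \<Longrightarrow> j < N \<Longrightarrow> lam i j \<le> mx"
    and lam_range: "\<And>i h h'. i < N \<Longrightarrow> h < N \<Longrightarrow> h' < N \<Longrightarrow> lam i h < lam i h' + L"
begin

definition good :: "state \<Rightarrow> bool" where
  "good s \<longleftrightarrow> s ''n'' 0 = N \<and> s ''mx'' 0 = mx \<and>
     (\<forall>i<N. \<forall>j<N. s (lb b) (pos N b i j) = lam i j) \<and>
     (\<forall>i<N. s (rr b) i \<le> 1 \<and> s (rr (\<not> b)) i \<le> 1)"

definition rows :: "state \<Rightarrow> nat set" where
  "rows s = {i. i < N \<and> s (rr b) i = 0}"

definition cols :: "state \<Rightarrow> nat set" where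
  "cols s = {i. i < N \<and> s (rr (\<not> b)) i = 0}"

definition edges :: "state \<Rightarrow> (nat \<times> nat) set" where
  "edges s = {(i, j). i < N \<and> j < N \<and> s ''out'' (pos N b i j) \<noteq> 0}"

lemma good_cong:
  "good s \<Longrightarrow> s' ''n'' = s ''n'' \<Longrightarrow> s' ''mx'' = s ''mx'' \<Longrightarrow> s' (lb b) = s (lb b) \<Longrightarrow>
    s' (rr b) = s (rr b) \<Longrightarrow> s' (rr (\<not> b)) = s (rr (\<not> b)) \<Longrightarrow> good s'"
  by (simp add: good_def)

lemma goodD:
  "good s \<Longrightarrow> s ''n'' 0 = N"
  "good s \<Longrightarrow> s ''mx'' 0 = mx"
  by (simp_all add: good_def)

lemma good_upd [simp]:
  "x \<notin> {''n'', ''mx'', lb b, rr b, rr (\<not> b)} \<Longrightarrow> good (s(x := f)) \<longleftrightarrow> good s"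
  by (auto simp: good_def)

lemma NW: "N < W" "mx < W" "N \<le> W" "1 \<le> W" "0 < W" "Suc mx \<le> W" "k < N \<Longrightarrow> k \<le> W"
  using W by auto

lemma pos_le_W: "i < N \<Longrightarrow> j < N \<Longrightarrow> pos N b' i j \<le> W"
  using pos_less[of i N j b'] W by simp

lemma afits_ix [simp]:
  assumes "s ''n'' 0 = N" "aval a s < N" "aval c s < N"
  shows "afits W (ix b' a c) s \<longleftrightarrow> afits W a s \<and> afits W c s"
  using pos_le_W[of "aval a s" "aval c s" b'] assms NW by (auto simp: ix_def pos_def split: if_splits)

lemma aval_lab [simp]:
  "good s \<Longrightarrow> aval a s < N \<Longrightarrow> aval c s < N \<Longrightarrow> aval (lab b a c) s = lam (aval a s) (aval c s)"
  by (simp add: lab_def good_def)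

lemma afits_lab [simp]:
  assumes "good s" "aval a s < N" "aval c s < N"
  shows "afits W (lab b a c) s \<longleftrightarrow> afits W a s \<and> afits W c s"
proof -
  have "s (lb b) (pos N b (aval a s) (aval c s)) \<le> W"
    using assms lam_le NW by (fastforce simp: good_def)
  then show ?thesis using assms by (simp add: lab_def goodD)
qed

lemma bfits_alive [simp]:
  assumes "good s" "aval a s < N"
  shows "bfits W (alive b a) s \<longleftrightarrow> afits W a s" "bfits W (alive (\<not> b) a) s \<longleftrightarrow> afits W a s"
proof -
  have "s (rr b) (aval a s) \<le> 1" "s (rr (\<not> b)) (aval a s) \<le> 1"
    using assms by (simp_all add: good_def)
  then have "s (rr b) (aval a s) \<le> W" "s (rr (\<not> b)) (aval a s) \<le> W" using NW by linarith+
  then show "bfits W (alive b a) s \<longleftrightarrow> afits W a s" "bfits W (alive (\<not> b) a) s \<longleftrightarrow> afits W a s"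
    using NW by (simp_all add: alive_def)
qed

lemma bval_alive [simp]:
  "aval a s < N \<Longrightarrow> bval (alive b a) s \<longleftrightarrow> aval a s \<in> rows s"
  "aval a s < N \<Longrightarrow> bval (alive (\<not> b) a) s \<longleftrightarrow> aval a s \<in> cols s"
  by (auto simp: alive_def rows_def cols_def)

lemma bcost_alive [simp]: "bcost (alive b' a) = acost a + 3"
  by (simp add: alive_def)

declare goodD [simp]

lemma finite_sets [simp]: "finite (rows s)" "finite (cols s)" "finite (edges s)"
  unfolding rows_def cols_def edges_def
  by (auto intro: finite_subset[of _ "{..<N} \<times> {..<N}"])

text \<open>\<open>v\<close> and \<open>w\<close> are the entries of \<open>bst\<close> and \<open>wit\<close> for hub \<open>h\<close> and column \<open>j\<close>.\<close>

definition wok :: "nat set \<Rightarrow> nat \<Rightarrow> nat \<Rightarrow> nat \<Rightarrow> nat \<Rightarrow> bool" where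
  "wok R v w h j \<longleftrightarrow> v = best lam R h j \<and> w < N \<and>
     (0 < v \<longrightarrow> w \<in> R \<and> lam w h \<le> lam w j \<and> v = Suc (lam w h))"

lemma wok_insert:
  "wok R v w h j \<Longrightarrow> finite R \<Longrightarrow> k < N \<Longrightarrow> lam k h \<le> lam k j \<Longrightarrow> v \<le> lam k h \<Longrightarrow>
    wok (insert k R) (Suc (lam k h)) k h j"
  "wok R v w h j \<Longrightarrow> finite R \<Longrightarrow> \<not> (lam k h \<le> lam k j \<and> v \<le> lam k h) \<Longrightarrow> wok (insert k R) v w h j"
  by (auto simp: wok_def best_insert)

definition tab :: "nat set \<Rightarrow> nat \<Rightarrow> nat \<Rightarrow> state \<Rightarrow> bool" where
  "tab R h j s \<longleftrightarrow> wok R (s ''bst'' (pos N True h j)) (s ''wit'' (pos N True h j)) h j"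

lemma tab_upd [simp]: "x \<noteq> ''bst'' \<Longrightarrow> x \<noteq> ''wit'' \<Longrightarrow> tab R h j (s(x := f)) \<longleftrightarrow> tab R h j s"
  by (simp add: tab_def)

lemma best_le: "R \<subseteq> {..<N} \<Longrightarrow> h < N \<Longrightarrow> best lam R h j \<le> Suc mx"
  unfolding best_def using lam_le by (subst Max_le_iff) (auto intro: finite_subset)

lemma tabD:
  assumes "tab R h j s" "R \<subseteq> {..<N}" "h < N"
  shows "s ''bst'' (pos N True h j) = best lam R h j" "s ''bst'' (pos N True h j) \<le> W"
    "s ''wit'' (pos N True h j) < N"
  using assms best_le[of R h j] NW by (auto simp: tab_def wok_def)

text \<open>Common rule for the two double loops over the tables: \<open>P\<close> describes a cell
  not yet visited, \<open>Q\<close> a finished one, and the body turns one into the other at its own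
  cell while preserving both at all other cells.\<close>

lemma wp_table:
  fixes P Q :: "nat \<Rightarrow> nat \<Rightarrow> state \<Rightarrow> bool"
  assumes g: "good s" and c: "written c = {''bst'', ''wit''}"
    and updP: "\<And>h j s x f. x \<in> {''h'', ''j''} \<Longrightarrow> P h j (s(x := f)) \<longleftrightarrow> P h j s"
    and updQ: "\<And>h j s x f. x \<in> {''h'', ''j''} \<Longrightarrow> Q h j (s(x := f)) \<longleftrightarrow> Q h j s"
    and P: "\<And>h j. h < N \<Longrightarrow> j < N \<Longrightarrow> P h j s"
    and body: "\<And>h j s'. h < N \<Longrightarrow> j < N \<Longrightarrow> good s' \<Longrightarrow> s' ''h'' 0 = h \<Longrightarrow> s' ''j'' 0 = j \<Longrightarrow>
      s' ''i'' = s ''i'' \<Longrightarrow> P h j s' \<Longrightarrow>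
      wp W c (\<lambda>m s''. m \<le> C \<and> Q h j s'' \<and> (\<forall>h'<N. \<forall>j'<N. (h', j') \<noteq> (h, j) \<longrightarrow>
        (P h' j' s' \<longrightarrow> P h' j' s'') \<and> (Q h' j' s' \<longrightarrow> Q h' j' s''))) s'"
  shows "wp W (FOR ''h'' (FOR ''j'' c)) (\<lambda>m s'. m \<le> (C + 42) * N * N \<and> (\<forall>h<N. \<forall>j<N. Q h j s')) s"
proof -
  \<comment> \<open>The cells lexicographically before \<open>(p, l)\<close> are finished.\<close>
  let ?I = "\<lambda>p l s'. \<forall>h<N. \<forall>j<N. if h < p \<or> h = p \<and> j < l then Q h j s' else P h j s'"
  have I_upd: "?I p l (s'(x := f)) \<longleftrightarrow> ?I p l s'" if "x \<in> {''h'', ''j''}" for p l s' x f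
    using updP[OF that] updQ[OF that] by simp
  have row: "wp W (FOR ''j'' c) (\<lambda>m s'. m \<le> (C + 21) * N \<and> ?I p N s') s'"
    if p: "p < N" "s' ''h'' 0 = p" "s' ''i'' = s ''i''" "good s'" "?I p 0 s'" for s' p
  proof (rule wp_FOR_const[where N = N and I = "?I p"])
    show "?I p 0 (s'(''j'' := (s' ''j'')(0 := 0)))"
      using p(5) by (subst I_upd) auto
  next
    fix l s''
    assume l: "l < N" and I: "?I p l s''" and j: "s'' ''j'' 0 = l"
      and fr: "\<And>y. y \<notin> insert ''j'' (written c) \<Longrightarrow> s'' y = s' y"
    have g: "good s''" using p(4) by (rule good_cong) (auto simp: fr c)
    have h: "s'' ''h'' 0 = p" "s'' ''i'' = s ''i''" using p fr c by auto
    have "P p l s''" using I p l by auto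
    from body[OF p(1) l g h(1) j h(2) this]
    show "wp W c (\<lambda>m s'. m \<le> C \<and> ?I p (Suc l) (s'(''j'' := (s' ''j'')(0 := Suc l)))) s''"
    proof (rule wp_mono, intro conjI)
      fix m t
      assume t: "m \<le> C \<and> Q p l t \<and> (\<forall>h'<N. \<forall>j'<N. (h', j') \<noteq> (p, l) \<longrightarrow>
        (P h' j' s'' \<longrightarrow> P h' j' t) \<and> (Q h' j' s'' \<longrightarrow> Q h' j' t))"
      then show "m \<le> C" by simp
      have "?I p (Suc l) t"
      proof (intro allI impI)
        fix h j assume hj: "h < N" "j < N"
        show "if h < p \<or> h = p \<and> j < Suc l then Q h j t else P h j t"
        proof (cases "(h, j) = (p, l)")
          case False
          then have "(h < p \<or> h = p \<and> j < Suc l) = (h < p \<or> h = p \<and> j < l)" by auto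
          moreover have "if h < p \<or> h = p \<and> j < l then Q h j s'' else P h j s''" using I hj by blast
          moreover have "P h j s'' \<longrightarrow> P h j t" "Q h j s'' \<longrightarrow> Q h j t" using t hj False by blast+
          ultimately show ?thesis by (auto split: if_splits)
        qed (use t in auto)
      qed
      then show "?I p (Suc l) (t(''j'' := (t ''j'')(0 := Suc l)))" by (subst I_upd) auto
    qed
  qed (use p NW N c in auto)
  have "wp W (FOR ''h'' (FOR ''j'' c)) (\<lambda>m s'. m \<le> ((C + 21) * N + 21) * N \<and> ?I N 0 s') s"
  proof (rule wp_FOR_const[where N = N and I = "\<lambda>p. ?I p 0"])
    show "?I 0 0 (s(''h'' := (s ''h'')(0 := 0)))"
      using P by (subst I_upd) auto
  next
    fix p s'
    assume p: "p < N" and I: "?I p 0 s'" and h: "s' ''h'' 0 = p"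
      and fr: "\<And>y. y \<notin> insert ''h'' (written (FOR ''j'' c)) \<Longrightarrow> s' y = s y"
    have g': "good s'" using g by (rule good_cong) (auto simp: fr c)
    have "s' ''i'' = s ''i''" using fr c by auto
    from row[OF p h this g' I]
    show "wp W (FOR ''j'' c) (\<lambda>m s''. m \<le> (C + 21) * N \<and>
        ?I (Suc p) 0 (s''(''h'' := (s'' ''h'')(0 := Suc p)))) s'"
    proof (rule wp_mono, intro conjI)
      fix m t
      assume t: "m \<le> (C + 21) * N \<and> ?I p N t"
      have "?I (Suc p) 0 t"
      proof (intro allI impI)
        fix h j assume hj: "h < N" "j < N"
        \<comment> \<open>The end of one table row is the start of the next.\<close>
        then have "(h < Suc p \<or> h = Suc p \<and> j < 0) = (h < p \<or> h = p \<and> j < N)" by auto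
        then show "if h < Suc p \<or> h = Suc p \<and> j < 0 then Q h j t else P h j t"
          using t hj by presburger
      qed
      then show "?I (Suc p) 0 (t(''h'' := (t ''h'')(0 := Suc p)))" by (subst I_upd) auto
    qed auto
  qed (use g NW N c in auto)
  then show ?thesis
  proof (rule wp_mono)
    fix m t assume t: "m \<le> ((C + 21) * N + 21) * N \<and> ?I N 0 t"
    have "(C + 21) * N + 21 \<le> (C + 42) * N" using N by (simp add: algebra_simps)
    then have "((C + 21) * N + 21) * N \<le> (C + 42) * N * N" by (rule mult_le_mono1)
    with t have "m \<le> (C + 42) * N * N" by (meson le_trans)
    then show "m \<le> (C + 42) * N * N \<and> (\<forall>h<N. \<forall>j<N. Q h j t)" using t by auto
  qed
qed

lemma wp_reset:
  assumes "good s"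
  shows "wp W reset (\<lambda>m s'. m \<le> 80 * N * N \<and> (\<forall>h<N. \<forall>j<N. tab {} h j s')) s"
  unfolding reset_def
proof (rule wp_mono[OF wp_table[where P = "\<lambda>h j s. True" and Q = "tab {}" and C = 38]])
  fix h j s' assume "h < N" "j < N" "good s'" "s' ''h'' 0 = h" "s' ''j'' 0 = j"
  then show "wp W
        (Seq (Assign ''bst'' (ix True (sc ''h'') (sc ''j'')) (Const 0))
          (Assign ''wit'' (ix True (sc ''h'') (sc ''j'')) (Const 0)))
        (\<lambda>m s''. m \<le> 38 \<and> tab {} h j s'' \<and> (\<forall>h'<N. \<forall>j'<N. (h', j') \<noteq> (h, j) \<longrightarrow>
          (True \<longrightarrow> True) \<and> (tab {} h' j' s' \<longrightarrow> tab {} h' j' s''))) s'"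
    using N NW by (simp add: tab_def wok_def)
qed (use assms in auto)

text \<open>The frame clause holds for every row set, because cells still to be visited are
  described by \<open>R\<close> and finished ones by \<open>insert k R\<close>.\<close>

lemma wp_scan_body:
  assumes "good s" "s ''i'' 0 = k" "s ''h'' 0 = h" "s ''j'' 0 = j" "k < N" "h < N" "j < N"
    and R: "R \<subseteq> {..<N}" and t: "tab R h j s"
  shows "wp W (scan_body b) (\<lambda>m s'. m \<le> 100 \<and> tab (insert k R) h j s' \<and>
    (\<forall>h'<N. \<forall>j'<N. \<forall>R. (h', j') \<noteq> (h, j) \<longrightarrow> tab R h' j' s' \<longleftrightarrow> tab R h' j' s)) s"
proof -
  let ?p = "pos N True h j"
  have fin: "finite R" using R finite_subset by blast
  have le: "lam k h \<le> W" "Suc (lam k h) \<le> W"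
    using lam_le[of k h] assms NW by linarith+
  have v: "s ''bst'' ?p \<le> W" using tabD[OF t R] assms by simp
  have p: "pos N True h' j' \<noteq> ?p" if "(h', j') \<noteq> (h, j)" "h' < N" "j' < N" for h' j'
    using that assms by simp
  show ?thesis
  proof (cases "lam k h \<le> lam k j \<and> s ''bst'' ?p \<le> lam k h")
    case True
    have "wok (insert k R) (Suc (lam k h)) k h j"
      using wok_insert(1)[OF t[unfolded tab_def] fin \<open>k < N\<close>] True by simp
    then show ?thesis
      using True le v NW p assms(1-7) by (simp add: scan_body_def tab_def not_less)
  next
    case False
    have "wok (insert k R) (s ''bst'' ?p) (s ''wit'' ?p) h j"
      using wok_insert(2)[OF t[unfolded tab_def] fin False] .
    then show ?thesis
      using False le v NW assms(1-7) by (simp add: scan_body_def tab_def not_less) blast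
  qed
qed

lemma wp_scan_row:
  assumes g: "good s" and i: "s ''i'' 0 = k" "k < N"
    and R: "R \<subseteq> {..<N}" and t: "\<forall>h<N. \<forall>j<N. tab R h j s"
  shows "wp W (FOR ''h'' (FOR ''j'' (scan_body b)))
    (\<lambda>m s'. m \<le> 142 * N * N \<and> (\<forall>h<N. \<forall>j<N. tab (insert k R) h j s')) s"
proof (rule wp_mono[OF wp_table[where P = "tab R" and Q = "tab (insert k R)" and C = 100]])
  fix h j s' assume "h < N" "j < N" "good s'" "s' ''h'' 0 = h" "s' ''j'' 0 = j" "s' ''i'' = s ''i''" "tab R h j s'"
  then show "wp W (scan_body b)
      (\<lambda>m s''. m \<le> 100 \<and> tab (insert k R) h j s'' \<and> (\<forall>h'<N. \<forall>j'<N. (h', j') \<noteq> (h, j) \<longrightarrow>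
        (tab R h' j' s' \<longrightarrow> tab R h' j' s'') \<and> (tab (insert k R) h' j' s' \<longrightarrow> tab (insert k R) h' j' s''))) s'"
    using i R by (intro wp_mono[OF wp_scan_body[of s' k h j R]]) auto
qed (use g t in auto)

text \<open>Only live rows pay for a pass over the table, so the leading term of the time counts
  \<open>rows s\<close> instead of \<open>N\<close>.\<close>

lemma wp_scan:
  assumes g: "good s" and t: "\<forall>h<N. \<forall>j<N. tab {} h j s"
  shows "wp W (scan b) (\<lambda>m s'. m \<le> 142 * N * N * card (rows s) + 40 * N \<and>
    (\<forall>h<N. \<forall>j<N. tab (rows s) h j s')) s"
  unfolding scan_def
proof (rule wp_FOR[where N = N and I = "\<lambda>k t s'. t \<le> 142 * N * N * card (rows s \<inter> {..<k}) + 12 * k \<and>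
    (\<forall>h<N. \<forall>j<N. tab (rows s \<inter> {..<k}) h j s')"])
  fix k t s'
  assume k: "k < N" and I: "t \<le> 142 * N * N * card (rows s \<inter> {..<k}) + 12 * k \<and>
    (\<forall>h<N. \<forall>j<N. tab (rows s \<inter> {..<k}) h j s')" and i: "s' ''i'' 0 = k"
    and fr: "\<And>y. y \<notin> insert ''i'' (written (IF (alive b (sc ''i'')) (FOR ''h'' (FOR ''j'' (scan_body b))))) \<Longrightarrow>
      s' y = s y"
  have g': "good s'" using g by (rule good_cong) (simp_all add: fr)
  have r: "rows s' = rows s" by (simp add: rows_def fr)
  have e: "rows s \<inter> {..<Suc k} = (if k \<in> rows s then insert k (rows s \<inter> {..<k}) else rows s \<inter> {..<k})"
    by (auto simp: less_Suc_eq)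
  have sub: "rows s \<inter> {..<k} \<subseteq> {..<N}" using k by auto
  have row: "wp W (FOR ''h'' (FOR ''j'' (scan_body b)))
      (\<lambda>m s''. m \<le> 142 * N * N \<and> (\<forall>h<N. \<forall>j<N. tab (insert k (rows s \<inter> {..<k})) h j s'')) s'"
    using wp_scan_row[OF g' i k sub] I by blast
  show "wp W (IF (alive b (sc ''i'')) (FOR ''h'' (FOR ''j'' (scan_body b))))
      (\<lambda>m s''. t + m \<le> 142 * N * N * card (rows s \<inter> {..<Suc k}) + 12 * Suc k \<and>
        (\<forall>h<N. \<forall>j<N. tab (rows s \<inter> {..<Suc k}) h j (s''(''i'' := (s'' ''i'')(0 := Suc k))))) s'"
  proof (cases "k \<in> rows s")
    case True
    show ?thesis
      using True g' i k NW r by (simp add: e) (rule wp_mono[OF row], use I in \<open>simp add: algebra_simps\<close>)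
  next
    case False
    then show ?thesis
      using I g' i k NW r by (simp add: e)
  qed
next
  fix t s'
  assume I: "t \<le> 142 * N * N * card (rows s \<inter> {..<N}) + 12 * N \<and>
    (\<forall>h<N. \<forall>j<N. tab (rows s \<inter> {..<N}) h j s')"
  have "rows s \<inter> {..<N} = rows s" by (auto simp: rows_def)
  then show "t + 12 * N + 9 \<le> 142 * N * N * card (rows s) + 40 * N \<and> (\<forall>h<N. \<forall>j<N. tab (rows s) h j s')"
    using I N by simp
qed (use assms NW N in auto)

text \<open>A running minimum by \<open>worst_insert\<close>, started at the value of
  \<open>worst\<close> for no columns.\<close>

lemma wp_minimize:
  assumes g: "good s" and h: "s ''h'' 0 = h" "h < N" and m: "s ''m'' 0 = Suc mx"
    and R: "R \<subseteq> {..<N}" and t: "\<forall>h<N. \<forall>j<N. tab R h j s"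
  shows "wp W (minimize b) (\<lambda>m s'. m \<le> 80 * N \<and> s' ''m'' 0 = worst lam mx R (cols s) h) s"
  unfolding minimize_def
proof (rule wp_mono[OF wp_FOR_const[where N = N and C = 59 and
    I = "\<lambda>k s'. s' ''m'' 0 = worst lam mx R (cols s \<inter> {..<k}) h"]])
  let ?c = "IF (BAnd (alive (\<not> b) (sc ''j'')) (Less (Cell ''bst'' (ix True (sc ''h'') (sc ''j''))) (sc ''m'')))
       (set_sc ''m'' (Cell ''bst'' (ix True (sc ''h'') (sc ''j''))))"
  fix k s'
  assume k: "k < N" and I: "s' ''m'' 0 = worst lam mx R (cols s \<inter> {..<k}) h" and j: "s' ''j'' 0 = k"
    and fr: "\<And>y. y \<notin> insert ''j'' (written ?c) \<Longrightarrow> s' y = s y"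
  have g': "good s'" using g by (rule good_cong) (simp_all add: fr)
  have c: "cols s' = cols s" by (simp add: cols_def fr)
  have e: "cols s \<inter> {..<Suc k} = (if k \<in> cols s then insert k (cols s \<inter> {..<k}) else cols s \<inter> {..<k})"
    by (auto simp: less_Suc_eq)
  have "tab R h k s'" using t k h by (simp add: tab_def fr)
  note t' = tabD(1,2)[OF this R h(2)]
  have h': "s' ''h'' 0 = h" using h by (simp add: fr)
  have m: "s' ''m'' 0 \<le> W" using worst_le_mx[of "cols s \<inter> {..<k}" lam mx R h] NW I by simp
  show "wp W ?c (\<lambda>m s''. m \<le> 59 \<and>
      (s''(''j'' := (s'' ''j'')(0 := Suc k))) ''m'' 0 = worst lam mx R (cols s \<inter> {..<Suc k}) h) s'"
    using k NW g' c h(2) h' t' m j by (simp add: e worst_insert set_sc_def flip: I)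
next
  fix m s'
  assume "m \<le> (59 + 21) * N \<and> s' ''m'' 0 = worst lam mx R (cols s \<inter> {..<N}) h"
  moreover have "cols s \<inter> {..<N} = cols s" by (auto simp: cols_def)
  ultimately show "m \<le> 80 * N \<and> s' ''m'' 0 = worst lam mx R (cols s) h" by simp
qed (use g m NW N in simp_all)

lemma wp_count:
  assumes g: "good s" and h: "s ''h'' 0 = h" "h < N" and m: "s ''m'' 0 = v" "v \<le> Suc mx"
    and c: "s ''c'' 0 = 0"
  shows "wp W (count b) (\<lambda>m s'. m \<le> 80 * N \<and> s' ''c'' 0 = card {i \<in> rows s. lam i h < v}) s"
  unfolding count_def
proof (rule wp_mono[OF wp_FOR_const[where N = N and C = 59 and
    I = "\<lambda>k s'. s' ''c'' 0 \<le> k \<and> s' ''c'' 0 = card {i \<in> rows s \<inter> {..<k}. lam i h < v}"]])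
  let ?c = "IF (BAnd (alive b (sc ''i'')) (Less (lab b (sc ''i'') (sc ''h'')) (sc ''m'')))
       (set_sc ''c'' (Plus (sc ''c'') (Const 1)))"
  fix k s'
  assume k: "k < N" and I: "s' ''c'' 0 \<le> k \<and> s' ''c'' 0 = card {i \<in> rows s \<inter> {..<k}. lam i h < v}"
    and i: "s' ''i'' 0 = k" and fr: "\<And>y. y \<notin> insert ''i'' (written ?c) \<Longrightarrow> s' y = s y"
  have g': "good s'" using g by (rule good_cong) (simp_all add: fr)
  have r: "rows s' = rows s" by (simp add: rows_def fr)
  have "{i \<in> rows s \<inter> {..<Suc k}. lam i h < v} = (if k \<in> rows s \<and> lam k h < v
      then insert k {i \<in> rows s \<inter> {..<k}. lam i h < v} else {i \<in> rows s \<inter> {..<k}. lam i h < v})"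
    by (auto simp: less_Suc_eq)
  then have e: "card {i \<in> rows s \<inter> {..<Suc k}. lam i h < v} =
      (if k \<in> rows s \<and> lam k h < v then Suc (s' ''c'' 0) else s' ''c'' 0)"
    using I by simp
  have vars: "s' ''h'' 0 = h" "s' ''m'' 0 = v" using h m by (simp_all add: fr)
  \<comment> \<open>The bound on the counter by \<open>k\<close>, carried in the invariant, makes
    its increment fit into a word.\<close>
  have le: "lam k h \<le> W" "v \<le> W" "s' ''c'' 0 \<le> W" "Suc (s' ''c'' 0) \<le> W"
    using lam_le[OF k h(2)] k I m NW by linarith+
  show "wp W ?c (\<lambda>m s''. m \<le> 59 \<and> (s''(''i'' := (s'' ''i'')(0 := Suc k))) ''c'' 0 \<le> Suc k \<and>
      (s''(''i'' := (s'' ''i'')(0 := Suc k))) ''c'' 0 = card {i \<in> rows s \<inter> {..<Suc k}. lam i h < v}) s'"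
    unfolding e using k NW g' r h(2) vars le i conjunct1[OF I] by (simp add: set_sc_def)
next
  fix m s'
  assume "m \<le> (59 + 21) * N \<and> s' ''c'' 0 \<le> N \<and> s' ''c'' 0 = card {i \<in> rows s \<inter> {..<N}. lam i h < v}"
  moreover have "rows s \<inter> {..<N} = rows s" by (auto simp: rows_def)
  ultimately show "m \<le> 80 * N \<and> s' ''c'' 0 = card {i \<in> rows s. lam i h < v}" by simp
qed (use g c NW N in simp_all)

text \<open>The threshold is only bounded by \<open>worst\<close>, not equal to it, because the
  initial threshold 0 survives if no hub has a positive count. The last clause is the optimality of
  the chosen hub.\<close>

lemma wp_select:
  assumes g: "good s" and R: "R = rows s" and t: "\<forall>h<N. \<forall>j<N. tab R h j s"
  shows "wp W (select b) (\<lambda>m s'. m \<le> 300 * N * N \<and> s' ''bh'' 0 < N \<and> s' ''bm'' 0 \<le> Suc mx \<and>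
    s' ''bm'' 0 \<le> worst lam mx R (cols s) (s' ''bh'' 0) \<and>
    (\<forall>h<N. card {i \<in> R. lam i h < worst lam mx R (cols s) h} \<le> card {i \<in> R. lam i (s' ''bh'' 0) < s' ''bm'' 0})) s"
proof -
  let ?c = "\<lambda>h v. card {i \<in> R. lam i h < v}"
  let ?w = "worst lam mx R (cols s)"
  let ?I = "\<lambda>k s'. s' ''bh'' 0 < N \<and> s' ''bm'' 0 \<le> Suc mx \<and> s' ''bm'' 0 \<le> ?w (s' ''bh'' 0) \<and>
    s' ''bc'' 0 = ?c (s' ''bh'' 0) (s' ''bm'' 0) \<and> (\<forall>h<k. ?c h (?w h) \<le> s' ''bc'' 0)"
  let ?upd = "IF (Less (sc ''bc'') (sc ''c''))
    (Seq (set_sc ''bc'' (sc ''c'')) (Seq (set_sc ''bm'' (sc ''m'')) (set_sc ''bh'' (sc ''h''))))"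
  let ?body = "Seq (set_sc ''m'' (Plus (sc ''mx'') (Const 1))) (Seq (minimize b)
    (Seq (set_sc ''c'' (Const 0)) (Seq (count b) ?upd)))"
  have RN: "R \<subseteq> {..<N}" using R by (auto simp: rows_def)
  have cle: "?c h v \<le> N" for h v
    using card_mono[of "{..<N}" "{i \<in> R. lam i h < v}"] RN by auto
  have wle: "?w h \<le> Suc mx" for h by (rule worst_le_mx) simp
  have le: "?w h \<le> W" "?c h v \<le> W" for h v
    using wle[of h] cle[of h v] NW by linarith+
  have body: "wp W ?body (\<lambda>m s''. m \<le> 220 * N \<and> ?I (Suc k) (s''(''h'' := (s'' ''h'')(0 := Suc k)))) s'"
    if k: "k < N" "s' ''h'' 0 = k" and g': "good s'" and r: "rows s' = R" "cols s' = cols s" and I: "?I k s'"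
      and t': "\<forall>h<N. \<forall>j<N. tab R h j s'" for k s'
  proof -
    let ?s1 = "s'(''m'' := (s' ''m'')(0 := Suc mx))"
    have "cols ?s1 = cols s" using r by (simp add: cols_def)
    then have min: "wp W (minimize b) (\<lambda>m s2. m \<le> 80 * N \<and> s2 ''m'' 0 = ?w k) ?s1"
      using wp_minimize[of ?s1 k R] k g' RN t' by simp
    have rest: "wp W (Seq (set_sc ''c'' (Const 0)) (Seq (count b) ?upd))
        (\<lambda>m s''. m \<le> 120 * N \<and> ?I (Suc k) (s''(''h'' := (s'' ''h'')(0 := Suc k)))) s2"
      if m2: "s2 ''m'' 0 = ?w k" and fr2: "\<And>y. y \<notin> written (minimize b) \<Longrightarrow> s2 y = ?s1 y" for s2
    proof -
      let ?s2 = "s2(''c'' := (s2 ''c'')(0 := 0))"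
      have g2: "good ?s2" using g' by (rule good_cong) (simp_all add: fr2)
      have "rows ?s2 = R" using r by (simp add: rows_def fr2)
      then have cnt: "wp W (count b) (\<lambda>m s3. m \<le> 80 * N \<and> s3 ''c'' 0 = ?c k (?w k)) ?s2"
        using wp_count[OF g2, of k "?w k"] k m2 wle by (simp add: fr2)
      have upd: "wp W ?upd (\<lambda>m s''. m \<le> 30 \<and> ?I (Suc k) (s''(''h'' := (s'' ''h'')(0 := Suc k)))) s3"
        if c3: "s3 ''c'' 0 = ?c k (?w k)" and fr3: "\<And>y. y \<notin> written (count b) \<Longrightarrow> s3 y = ?s2 y" for s3
      proof -
        have b: "s3 ''bc'' = s' ''bc''" "s3 ''bm'' = s' ''bm''" "s3 ''bh'' = s' ''bh''"
          "s3 ''h'' 0 = k" "s3 ''m'' 0 = ?w k"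
          using k m2 by (simp_all add: fr2 fr3)
        have "s' ''bc'' 0 \<le> W" using I le by simp
        then show ?thesis
          using b c3 I le NW N k wle by (auto simp: set_sc_def less_Suc_eq)
      qed
      show ?thesis
      proof (rule wp_set_Seq[where a = 3 and v = 0])
        have "wp W (count b) (\<lambda>m. wp W ?upd (\<lambda>m2 s''. 3 + (m + m2) \<le> 120 * N \<and>
            ?I (Suc k) (s''(''h'' := (s'' ''h'')(0 := Suc k))))) ?s2"
        proof (rule wp_frame[OF cnt])
          fix m s3 assume m: "m \<le> 80 * N \<and> s3 ''c'' 0 = ?c k (?w k)"
            and "\<And>y. y \<notin> written (count b) \<Longrightarrow> s3 y = ?s2 y"
          from upd[OF conjunct2[OF m] this(2)]
          show "wp W ?upd (\<lambda>m2 s''. 3 + (m + m2) \<le> 120 * N \<and>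
            ?I (Suc k) (s''(''h'' := (s'' ''h'')(0 := Suc k)))) s3"
            by (rule wp_mono) (use m N in auto)
        qed
        then show "wp W (Seq (count b) ?upd) (\<lambda>m s''. 3 + m \<le> 120 * N \<and>
            ?I (Suc k) (s''(''h'' := (s'' ''h'')(0 := Suc k)))) ?s2"
          by (simp only: wp_Seq)
      qed auto
    qed
    have "wp W (minimize b) (\<lambda>m. wp W (Seq (set_sc ''c'' (Const 0)) (Seq (count b) ?upd))
        (\<lambda>m2 s''. 6 + (m + m2) \<le> 220 * N \<and> ?I (Suc k) (s''(''h'' := (s'' ''h'')(0 := Suc k))))) ?s1"
    proof (rule wp_frame[OF min])
      fix m s2 assume m: "m \<le> 80 * N \<and> s2 ''m'' 0 = ?w k"
        and "\<And>y. y \<notin> written (minimize b) \<Longrightarrow> s2 y = ?s1 y"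
      from rest[OF conjunct2[OF m] this(2)]
      show "wp W (Seq (set_sc ''c'' (Const 0)) (Seq (count b) ?upd))
        (\<lambda>m2 s''. 6 + (m + m2) \<le> 220 * N \<and> ?I (Suc k) (s''(''h'' := (s'' ''h'')(0 := Suc k)))) s2"
        by (rule wp_mono) (use m N in auto)
    qed
    then show ?thesis
      by (intro wp_set_Seq[where a = 6 and v = "Suc mx"], simp_all only: wp_Seq) (use g' NW in simp_all)
  qed
  let ?s0 = "s(''bh'' := (s ''bh'')(0 := 0), ''bm'' := (s ''bm'')(0 := 0), ''bc'' := (s ''bc'')(0 := 0))"
  have loop: "wp W (FOR ''h'' ?body) (\<lambda>m s'. m \<le> (220 * N + 21) * N \<and> ?I N s') ?s0"
  proof (rule wp_FOR_const[where N = N and I = ?I])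
    fix k s'
    assume k: "k < N" and I: "?I k s'" and h: "s' ''h'' 0 = k"
      and fr: "\<And>y. y \<notin> insert ''h'' (written ?body) \<Longrightarrow> s' y = ?s0 y"
    have "good s'" using g by (rule good_cong) (simp_all add: fr)
    moreover have "rows s' = R" "cols s' = cols s" by (simp_all add: R rows_def cols_def fr)
    moreover have "\<forall>h<N. \<forall>j<N. tab R h j s'" using t by (simp add: tab_def fr)
    ultimately show "wp W ?body (\<lambda>m s''. m \<le> 220 * N \<and> ?I (Suc k) (s''(''h'' := (s'' ''h'')(0 := Suc k)))) s'"
      using k h I by (intro body[of k s'])
  qed (use g N NW in simp_all)
  \<comment> \<open>The 9 is the cost of the three initial assignments.\<close>
  have "9 + (220 * N + 21) * N \<le> 300 * N * N"
  proof -
    have "9 + (220 * N + 21) * N \<le> 9 * N * N + (220 * N + 21 * N) * N"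
      using N by (intro add_mono mult_le_mono1) auto
    also have "\<dots> \<le> 300 * N * N" by simp
    finally show ?thesis .
  qed
  then have "wp W (FOR ''h'' ?body) (\<lambda>m s'. 3 + (3 + (3 + m)) \<le> 300 * N * N \<and> ?I N s') ?s0"
    by (intro wp_mono[OF loop]) auto
  then have "wp W (FOR ''h'' ?body) (\<lambda>m s'. 3 + (3 + (3 + m)) \<le> 300 * N * N \<and> s' ''bh'' 0 < N \<and> s' ''bm'' 0 \<le> Suc mx \<and>
    s' ''bm'' 0 \<le> ?w (s' ''bh'' 0) \<and> (\<forall>h<N. ?c h (?w h) \<le> ?c (s' ''bh'' 0) (s' ''bm'' 0))) ?s0"
    by (rule wp_mono) auto
  then show ?thesis
    unfolding select_def by (intro wp_set_Seq[where a = 3 and v = 0]) simp_all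
qed

text \<open>That \<open>w j < N\<close> holds for default witnesses too keeps every written address
  inside the output matrix.\<close>

lemma wp_mark_cols:
  assumes g: "good s" and bh: "s ''bh'' 0 = h" "h < N"
    and w: "\<And>j. j < N \<Longrightarrow> w j = s ''wit'' (pos N True h j)" "\<And>j. j < N \<Longrightarrow> w j < N"
  shows "wp W (mark_cols b) (\<lambda>m s'. m \<le> 60 * N \<and> edges s' = edges s \<union> (\<lambda>j. (w j, j)) ` cols s) s"
  unfolding mark_cols_def
proof (rule wp_mono[OF wp_FOR_const[where N = N and C = 39 and
    I = "\<lambda>k s'. edges s' = edges s \<union> (\<lambda>j. (w j, j)) ` (cols s \<inter> {..<k})"]])
  let ?c = "IF (alive (\<not> b) (sc ''j''))
     (Assign ''out'' (ix b (Cell ''wit'' (ix True (sc ''bh'') (sc ''j''))) (sc ''j'')) (Const 1))"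
  fix k s'
  assume k: "k < N" and I: "edges s' = edges s \<union> (\<lambda>j. (w j, j)) ` (cols s \<inter> {..<k})" and j: "s' ''j'' 0 = k"
    and fr: "\<And>y. y \<notin> insert ''j'' (written ?c) \<Longrightarrow> s' y = s y"
  have g': "good s'" using g by (rule good_cong) (simp_all add: fr)
  have c: "cols s' = cols s" by (simp add: cols_def fr)
  have e: "cols s \<inter> {..<Suc k} = (if k \<in> cols s then insert k (cols s \<inter> {..<k}) else cols s \<inter> {..<k})"
    by (auto simp: less_Suc_eq)
  have bh': "s' ''bh'' 0 = h" "s' ''wit'' (pos N True h k) = w k" using bh w k by (simp_all add: fr)
  have "edges (s'(''out'' := (s' ''out'')(pos N b (w k) k := 1))) = insert (w k, k) (edges s')"
    using w(2)[OF k] k by (auto simp: edges_def)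
  moreover have "edges (s''(''j'' := f)) = edges s''" for s'' f by (simp add: edges_def)
  moreover have "w k \<le> W" using w(2)[OF k] NW by simp
  ultimately show "wp W ?c (\<lambda>m s''. m \<le> 39 \<and> edges (s''(''j'' := (s'' ''j'')(0 := Suc k))) =
      edges s \<union> (\<lambda>j. (w j, j)) ` (cols s \<inter> {..<Suc k})) s'"
    using k NW g' c bh(2) bh' j w(2)[OF k] I by (simp add: e)
next
  fix m s'
  assume "m \<le> (39 + 21) * N \<and> edges s' = edges s \<union> (\<lambda>j. (w j, j)) ` (cols s \<inter> {..<N})"
  moreover have "cols s \<inter> {..<N} = cols s" by (auto simp: cols_def)
  ultimately show "m \<le> 60 * N \<and> edges s' = edges s \<union> (\<lambda>j. (w j, j)) ` cols s" by simp
qed (use g NW N in \<open>simp_all add: edges_def\<close>)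

lemma wp_mark_rows:
  assumes g: "good s" and bh: "s ''bh'' 0 = h" "h < N" and bm: "s ''bm'' 0 = v" "v \<le> Suc mx"
  shows "wp W (mark_rows b) (\<lambda>m s'. m \<le> 80 * N \<and> good s' \<and> edges s' = edges s \<union> rows s \<times> {h} \<and>
    rows s' = {i \<in> rows s. \<not> lam i h < v}) s"
  unfolding mark_rows_def
proof (rule wp_mono[OF wp_FOR_const[where N = N and C = 59 and
    I = "\<lambda>k s'. good s' \<and> edges s' = edges s \<union> (rows s \<inter> {..<k}) \<times> {h} \<and>
      rows s' = {i \<in> rows s. i < k \<longrightarrow> \<not> lam i h < v}"]])
  let ?c = "IF (alive b (sc ''i''))
     (Seq (Assign ''out'' (ix b (sc ''i'') (sc ''bh'')) (Const 1))
       (IF (Less (lab b (sc ''i'') (sc ''bh'')) (sc ''bm'')) (Assign (rr b) (sc ''i'') (Const 1))))"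
  fix k s'
  assume k: "k < N" and I: "good s' \<and> edges s' = edges s \<union> (rows s \<inter> {..<k}) \<times> {h} \<and>
      rows s' = {i \<in> rows s. i < k \<longrightarrow> \<not> lam i h < v}" and i: "s' ''i'' 0 = k"
    and fr: "\<And>y. y \<notin> insert ''i'' (written ?c) \<Longrightarrow> s' y = s y"
  have e: "rows s \<inter> {..<Suc k} = (if k \<in> rows s then insert k (rows s \<inter> {..<k}) else rows s \<inter> {..<k})"
    by (auto simp: less_Suc_eq)
  have b: "s' ''bh'' 0 = h" "s' ''bm'' 0 = v" using bh bm by (simp_all add: fr)
  have le: "lam k h \<le> W" "v \<le> W" "h \<le> W" using lam_le[OF k bh(2)] bm bh NW by linarith+
  \<comment> \<open>Rows are killed in the pass that draws the star, but row \<open>k\<close> is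
    untouched until the loop reaches it, so the star covers all original rows.\<close>
  have kr: "k \<in> rows s' \<longleftrightarrow> k \<in> rows s" using I by simp
  let ?s1 = "s'(''out'' := (s' ''out'')(pos N b k h := 1))"
  let ?s2 = "?s1(rr b := (?s1 (rr b))(k := 1))"
  have e1: "edges ?s1 = insert (k, h) (edges s')" "edges ?s2 = insert (k, h) (edges s')"
    using k bh by (auto simp: edges_def)
  have r1: "rows ?s1 = rows s'" "rows ?s2 = rows s' - {k}" by (auto simp: rows_def)
  have upd: "edges (s''(''i'' := f)) = edges s''" "rows (s''(''i'' := f)) = rows s''" for s'' f
    by (simp_all add: edges_def rows_def)
  have g2: "good ?s2"
    using conjunct1[OF I] by (simp add: good_def del: goodD)
  have J: "{i \<in> rows s. i < Suc k \<longrightarrow> \<not> lam i h < v} =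
      (if k \<in> rows s \<and> lam k h < v then rows s' - {k} else rows s')"
    using I by (auto simp: less_Suc_eq)
  show "wp W ?c (\<lambda>m s''. m \<le> 59 \<and> good (s''(''i'' := (s'' ''i'')(0 := Suc k))) \<and>
      edges (s''(''i'' := (s'' ''i'')(0 := Suc k))) = edges s \<union> (rows s \<inter> {..<Suc k}) \<times> {h} \<and>
      rows (s''(''i'' := (s'' ''i'')(0 := Suc k))) = {i \<in> rows s. i < Suc k \<longrightarrow> \<not> lam i h < v}) s'"
    unfolding J using k NW conjunct1[OF I] bh(2) b i le kr conjunct1[OF conjunct2[OF I]] e1 r1 g2
    by (simp add: e upd)
next
  fix m s'
  assume "m \<le> (59 + 21) * N \<and> good s' \<and> edges s' = edges s \<union> (rows s \<inter> {..<N}) \<times> {h} \<and>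
      rows s' = {i \<in> rows s. i < N \<longrightarrow> \<not> lam i h < v}"
  moreover have "rows s \<inter> {..<N} = rows s" by (auto simp: rows_def)
  moreover have "{i \<in> rows s. i < N \<longrightarrow> \<not> lam i h < v} = {i \<in> rows s. \<not> lam i h < v}"
    by (auto simp: rows_def)
  ultimately show "m \<le> 80 * N \<and> good s' \<and> edges s' = edges s \<union> rows s \<times> {h} \<and>
      rows s' = {i \<in> rows s. \<not> lam i h < v}" by simp
qed (use g NW N in \<open>simp_all add: edges_def rows_def\<close>)

lemma wp_round:
  assumes g: "good s"
  shows "wp W (round b) (\<lambda>m s'. m \<le> 600 * N * N * (card (rows s) + 1) \<and> good s' \<and>
    round_step N L lam (rows s) (cols s) (edges s) (rows s') (edges s')) s"
proof -
  let ?R = "rows s" and ?Q = "cols s"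
  let ?w = "worst lam mx ?R ?Q"
  have RN: "?R \<subseteq> {..<N}" by (auto simp: rows_def)
  have QN: "?Q \<subseteq> {..<N}" by (auto simp: cols_def)
  \<comment> \<open>The program does not compute \<open>h0\<close>; by optimality the hub found by
    \<open>select\<close> removes at least as many rows.\<close>
  obtain h0 where h0: "h0 < N" "card ?R \<le> L * card {i \<in> ?R. lam i h0 < ?w h0}"
    using good_hub[of ?R ?Q N lam mx L] RN QN N lam_le lam_range by (auto simp: subset_iff)
  show ?thesis
    unfolding round_def wp_Seq
  proof (rule wp_frame[OF wp_reset[OF g]])
    fix m1 s1
    assume 1: "m1 \<le> 80 * N * N \<and> (\<forall>h<N. \<forall>j<N. tab {} h j s1)"
      and f1: "\<And>y. y \<notin> written reset \<Longrightarrow> s1 y = s y"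
    have g1: "good s1" using g by (rule good_cong) (simp_all add: f1)
    have s1: "rows s1 = ?R" "cols s1 = ?Q" "edges s1 = edges s"
      by (simp_all add: rows_def cols_def edges_def f1)
    show "wp W (scan b) (\<lambda>m2. wp W (select b) (\<lambda>m3. wp W (mark_cols b) (\<lambda>m4. wp W (mark_rows b)
      (\<lambda>m5 s'. m1 + (m2 + (m3 + (m4 + m5))) \<le> 600 * N * N * (card ?R + 1) \<and> good s' \<and>
        round_step N L lam ?R ?Q (edges s) (rows s') (edges s'))))) s1"
    proof (rule wp_frame[OF wp_scan[OF g1 conjunct2[OF 1]]])
      fix m2 s2
      assume 2: "m2 \<le> 142 * N * N * card (rows s1) + 40 * N \<and> (\<forall>h<N. \<forall>j<N. tab (rows s1) h j s2)"
        and f2: "\<And>y. y \<notin> written (scan b) \<Longrightarrow> s2 y = s1 y"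
      have g2: "good s2" using g1 by (rule good_cong) (simp_all add: f2)
      have s2: "rows s2 = ?R" "cols s2 = ?Q" "edges s2 = edges s"
        using s1 by (simp_all add: rows_def cols_def edges_def f2)
      have t2: "\<forall>h<N. \<forall>j<N. tab ?R h j s2" using 2 s1 by simp
      show "wp W (select b) (\<lambda>m3. wp W (mark_cols b) (\<lambda>m4. wp W (mark_rows b)
        (\<lambda>m5 s'. m1 + (m2 + (m3 + (m4 + m5))) \<le> 600 * N * N * (card ?R + 1) \<and> good s' \<and>
          round_step N L lam ?R ?Q (edges s) (rows s') (edges s')))) s2"
      proof (rule wp_frame[OF wp_select[OF g2 s2(1)[symmetric] t2]])
        fix m3 s3
        assume 3: "m3 \<le> 300 * N * N \<and> s3 ''bh'' 0 < N \<and> s3 ''bm'' 0 \<le> Suc mx \<and>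
            s3 ''bm'' 0 \<le> worst lam mx ?R (cols s2) (s3 ''bh'' 0) \<and>
            (\<forall>h<N. card {i \<in> ?R. lam i h < worst lam mx ?R (cols s2) h}
              \<le> card {i \<in> ?R. lam i (s3 ''bh'' 0) < s3 ''bm'' 0})"
          and f3: "\<And>y. y \<notin> written (select b) \<Longrightarrow> s3 y = s2 y"
        define h where "h = s3 ''bh'' 0"
        define v where "v = s3 ''bm'' 0"
        define w where "w j = s3 ''wit'' (pos N True h j)" for j
        have hv: "h < N" "v \<le> Suc mx" "v \<le> ?w h"
          "card {i \<in> ?R. lam i h0 < ?w h0} \<le> card {i \<in> ?R. lam i h < v}"
          using 3 s2 h0(1) by (simp_all add: h_def v_def)
        have g3: "good s3" using g2 by (rule good_cong) (simp_all add: f3)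
        have s3: "rows s3 = ?R" "cols s3 = ?Q" "edges s3 = edges s"
          using s2 by (simp_all add: rows_def cols_def edges_def f3)
        have t3: "wok ?R (s3 ''bst'' (pos N True h j)) (w j) h j" if "j < N" for j
          using t2 that hv(1) by (simp add: tab_def w_def f3)
        then have w: "w j < N" if "j < N" for j using that by (auto simp: wok_def)
        show "wp W (mark_cols b) (\<lambda>m4. wp W (mark_rows b)
          (\<lambda>m5 s'. m1 + (m2 + (m3 + (m4 + m5))) \<le> 600 * N * N * (card ?R + 1) \<and> good s' \<and>
            round_step N L lam ?R ?Q (edges s) (rows s') (edges s'))) s3"
        proof (rule wp_frame[OF wp_mark_cols[OF g3 h_def[symmetric] hv(1) w_def w]])
          fix m4 s4
          assume 4: "m4 \<le> 60 * N \<and> edges s4 = edges s3 \<union> (\<lambda>j. (w j, j)) ` cols s3"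
            and f4: "\<And>y. y \<notin> written (mark_cols b) \<Longrightarrow> s4 y = s3 y"
          have g4: "good s4" using g3 by (rule good_cong) (simp_all add: f4)
          have s4: "rows s4 = ?R" using s3 by (simp add: rows_def f4)
          have b4: "s4 ''bh'' 0 = h" "s4 ''bm'' 0 = v" by (simp_all add: f4 h_def v_def)
          show "wp W (mark_rows b)
            (\<lambda>m5 s'. m1 + (m2 + (m3 + (m4 + m5))) \<le> 600 * N * N * (card ?R + 1) \<and> good s' \<and>
              round_step N L lam ?R ?Q (edges s) (rows s') (edges s')) s4"
          proof (rule wp_mono[OF wp_mark_rows[OF g4 b4(1) hv(1) b4(2) hv(2)]])
            fix m5 s5
            assume 5: "m5 \<le> 80 * N \<and> good s5 \<and> edges s5 = edges s4 \<union> rows s4 \<times> {h} \<and>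
              rows s5 = {i \<in> rows s4. \<not> lam i h < v}"
            have NN: "N \<le> N * N" using N by simp
            have "m1 + (m2 + (m3 + (m4 + m5))) \<le> 142 * (N * N * card ?R) + 380 * (N * N) + 180 * N"
              using 1 2 3 4 5 s1 by (simp add: algebra_simps)
            also have "\<dots> \<le> 600 * (N * N * card ?R) + 600 * (N * N)" using NN by linarith
            finally have time: "m1 + (m2 + (m3 + (m4 + m5))) \<le> 600 * N * N * (card ?R + 1)"
              by (simp add: algebra_simps)
            have r5: "rows s5 = {i \<in> ?R. \<not> lam i h < v}" using 5 s4 by simp
            then have D: "?R - rows s5 = {i \<in> ?R. lam i h < v}" by auto
            have "round_step N L lam ?R ?Q (edges s) (rows s5) (edges s5)"
              unfolding round_step_def
            proof (intro exI[of _ h] exI[of _ w] conjI ballI)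
              show "h < N" by (rule hv)
              show "rows s5 \<subseteq> ?R" using r5 by auto
              show "edges s5 = edges s \<union> ?R \<times> {h} \<union> (\<lambda>j. (w j, j)) ` ?Q"
                using 4 5 s3 s4 by auto
              show "card ?R \<le> L * card (?R - rows s5)"
                unfolding D using h0(2) hv(4) by (meson le_trans mult_le_mono2)
            next
              fix i j assume i: "i \<in> ?R - rows s5" and j: "j \<in> ?Q"
              then have jN: "j < N" using QN by auto
              \<comment> \<open>A removed row has a label below \<open>best\<close>, so this entry
                is positive and its witness genuine; \<open>best\<close> being the witness label
                plus one gives \<open>lam i h \<le> lam (w j) h\<close>.\<close>
              have "v \<le> best lam ?R h j" using hv(3) worst_le[OF _ j, of lam mx ?R h] by simp
              moreover have "lam i h < v" using i D by auto
              ultimately have k: "w j < N" "w j \<in> ?R" "lam (w j) h \<le> lam (w j) j" "lam i h \<le> lam (w j) h"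
                using t3[OF jN] by (auto simp: wok_def)
              show "w j < N" "w j \<in> ?R" "lam (w j) h \<le> lam (w j) j" "lam i h \<le> lam (w j) h"
                by (rule k)+
            qed
            then show "m1 + (m2 + (m3 + (m4 + m5))) \<le> 600 * N * N * (card ?R + 1) \<and> good s5 \<and>
              round_step N L lam ?R ?Q (edges s) (rows s5) (edges s5)"
              using time 5 by blast
          qed
        qed
      qed
    qed
  qed
qed

end

lemma written_round [simp]:
  "written (round b) = {''h'', ''j'', ''bst'', ''wit'', ''i'', ''bh'', ''bm'', ''bc'', ''m'', ''c'', ''out'', rr b}"
  by (auto simp: round_def)

section \<open>Preprocessing of the labels and the complete program\<close>

text \<open>\<open>L\<close> is not part of the input, so the constant from which labels are
  complemented is the largest label present.\<close>

definition max_label :: com where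
  "max_label = FOR ''i'' (FOR ''j'' (IF (Less (sc ''mx'') (lab True (sc ''i'') (sc ''j'')))
     (set_sc ''mx'' (lab True (sc ''i'') (sc ''j'')))))"

definition negate :: com where
  "negate = FOR ''i'' (FOR ''j'' (Assign ''neg'' (ix True (sc ''i'') (sc ''j''))
     (Minus (sc ''mx'') (lab True (sc ''i'') (sc ''j'')))))"

text \<open>Every iteration kills a row as long as one is alive, so \<open>n\<close> iterations suffice.\<close>

definition bispanner_prog :: com where
  "bispanner_prog = Seq max_label (Seq negate (FOR ''k'' (Seq (round True) (round False))))"

section \<open>Amortized edge count\<close>

text \<open>Every live vertex holds a credit of \<open>2 * L\<close> edges; initially the credits
  add up to exactly \<open>4 * L * N\<close>. A pair is settled once one of its endpoints is
  dead.\<close>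

definition cover_inv ::
  "nat \<Rightarrow> nat \<Rightarrow> (nat \<Rightarrow> nat \<Rightarrow> nat) \<Rightarrow> nat set \<Rightarrow> nat set \<Rightarrow> (nat \<times> nat) set \<Rightarrow> bool" where
  "cover_inv N L lam R Q E \<longleftrightarrow> card E + 2 * L * (card R + card Q) \<le> 4 * L * N \<and>
    (\<forall>i<N. \<forall>j<N. i \<notin> R \<or> j \<notin> Q \<longrightarrow> reach lam E i j)"

text \<open>The two rounds together add at most \<open>2 * (card R + card Q)\<close> edges, as the
  second one sees \<open>R'\<close> with \<open>card R' \<le> card R\<close>. The credits released
  by the removed rows and columns cover this by \<open>round_step_removed\<close>.\<close>

lemma cover_inv_step:
  assumes inv: "cover_inv N L lam R Q E"
    and 1: "round_step N L lam R Q E R' E1"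
    and 2: "round_step N L (\<lambda>j i. mx - lam i j) Q R' (E1\<inverse>) Q' (E2\<inverse>)"
    and fin: "finite R" "finite Q" "finite E" "finite E1"
    and le: "\<And>i j. (i, j) \<in> E2 \<Longrightarrow> lam i j \<le> mx"
  shows "cover_inv N L lam R' Q' E2"
  unfolding cover_inv_def
proof (intro conjI allI impI)
  have R': "R' \<subseteq> R" "E \<subseteq> E1" "E1 \<subseteq> E2"
    using round_step_subset[OF 1] round_step_subset[OF 2] by auto
  then have "finite R'" "card R' \<le> card R" using fin finite_subset card_mono by blast+
  have "card E1 \<le> card E + card R + card Q" using round_step_card[OF 1] fin by simp
  moreover have "card E2 \<le> card E1 + card Q + card R'"
    using round_step_card[OF 2] fin \<open>finite R'\<close> by simp
  moreover note round_step_removed(1)[OF 1] round_step_removed(1)[OF 2]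
  ultimately show "card E2 + 2 * L * (card R' + card Q') \<le> 4 * L * N"
    using inv \<open>card R' \<le> card R\<close> fin by (simp add: cover_inv_def algebra_simps)
  fix i j assume ij: "i < N" "j < N" "i \<notin> R' \<or> j \<notin> Q'"
  \<comment> \<open>Split by when the first endpoint dies: before the iteration, in its first round,
    or in its second round, whose columns are \<open>R'\<close>.\<close>
  consider "i \<notin> R \<or> j \<notin> Q" | "i \<in> R - R'" "j \<in> Q" | "i \<in> R'" "j \<in> Q - Q'"
    using ij R' by blast
  then show "reach lam E2 i j"
  proof cases
    case 1
    then have "reach lam E i j" using inv ij by (simp add: cover_inv_def)
    then show ?thesis using R' by (blast intro: reach_mono)
  next
    case 2
    then show ?thesis using round_step_reach[OF 1] R' by (blast intro: reach_mono)
  next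
    case 3
    then have "reach (\<lambda>j i. mx - lam i j) (E2\<inverse>) j i" using round_step_reach[OF 2] by blast
    then show ?thesis using le by (rule reach_transpose[rotated])
  qed
qed

section \<open>Analysis of the complete program on a label matrix\<close>

locale labels =
  fixes W N L :: nat and lam :: "nat \<Rightarrow> nat \<Rightarrow> nat"
  assumes N: "0 < N" and W: "N * N + N + L + 5 \<le> W"
    and lam: "\<And>i j. i < N \<Longrightarrow> j < N \<Longrightarrow> 1 \<le> lam i j \<and> lam i j \<le> L"
begin

definition stored :: "state \<Rightarrow> bool" where
  "stored s \<longleftrightarrow> s ''n'' 0 = N \<and> (\<forall>i<N. \<forall>j<N. s ''lab'' (pos N True i j) = lam i j)"

lemma fits_ix [simp]:
  assumes "s ''n'' 0 = N" "aval a s < N" "aval c s < N"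
  shows "afits W (ix b a c) s \<longleftrightarrow> afits W a s \<and> afits W c s"
proof -
  interpret round_context W N L L lam True
  proof
    show "lam i h < lam i h' + L" if "i < N" "h < N" "h' < N" for i h h'
      using lam[OF that(1,2)] lam[OF that(1,3)] by simp
  qed (use N W lam in auto)
  show ?thesis using assms by (rule afits_ix)
qed

lemma stored_lab [simp]:
  assumes "stored s" "aval a s < N" "aval c s < N"
  shows "aval (lab True a c) s = lam (aval a s) (aval c s)"
    and "afits W (lab True a c) s \<longleftrightarrow> afits W a s \<and> afits W c s"
  using assms lam[of "aval a s" "aval c s"] W by (auto simp: stored_def lab_def lb_def)

lemma storedD: "stored s \<Longrightarrow> s ''n'' 0 = N"
  by (simp add: stored_def)

lemma stored_cong: "stored s \<Longrightarrow> s' ''n'' = s ''n'' \<Longrightarrow> s' ''lab'' = s ''lab'' \<Longrightarrow> stored s'"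
  by (simp add: stored_def)

lemma wp_max_label:
  assumes st: "stored s" and mx: "s ''mx'' 0 = 0"
  shows "wp W max_label (\<lambda>m s'. m \<le> 100 * N * N \<and> s' ''mx'' 0 \<le> L \<and>
    (\<forall>i<N. \<forall>j<N. lam i j \<le> s' ''mx'' 0)) s"
proof -
  let ?c = "IF (Less (sc ''mx'') (lab True (sc ''i'') (sc ''j''))) (set_sc ''mx'' (lab True (sc ''i'') (sc ''j'')))"
  let ?I = "\<lambda>k l s'. s' ''mx'' 0 \<le> L \<and> (\<forall>i<N. \<forall>j<N. i < k \<or> i = k \<and> j < l \<longrightarrow> lam i j \<le> s' ''mx'' 0)"
  have NW: "N < W" "L \<le> W" "0 < W" "N \<le> W" using W by auto
  have row: "wp W (FOR ''j'' ?c) (\<lambda>m s'. m \<le> (50 + 21) * N \<and> ?I k N s') s'"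
    if k: "k < N" "s' ''i'' 0 = k" "stored s'" "?I k 0 s'" for s' k
  proof (rule wp_FOR_const[where N = N and I = "?I k"])
    fix l s''
    assume l: "l < N" and I: "?I k l s''" and j: "s'' ''j'' 0 = l"
      and fr: "\<And>y. y \<notin> insert ''j'' (written ?c) \<Longrightarrow> s'' y = s' y"
    have st: "stored s''" using k(3) by (rule stored_cong) (simp_all add: fr)
    have i: "s'' ''i'' 0 = k" using k(2) by (simp add: fr)
    have "lam k l \<le> L" using lam k l by blast
    moreover have "s'' ''mx'' 0 \<le> W" using I NW by simp
    moreover have "\<forall>i<N. \<forall>j<N. i < k \<or> i = k \<and> j < l \<longrightarrow>
        lam i j \<le> (if s'' ''mx'' 0 < lam k l then lam k l else s'' ''mx'' 0)"
    proof (intro allI impI)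
      fix i j assume "i < N" "j < N" "i < k \<or> i = k \<and> j < l"
      then have "lam i j \<le> s'' ''mx'' 0" using I by blast
      then show "lam i j \<le> (if s'' ''mx'' 0 < lam k l then lam k l else s'' ''mx'' 0)" by simp
    qed
    ultimately show "wp W ?c (\<lambda>m t. m \<le> 50 \<and> ?I k (Suc l) (t(''j'' := (t ''j'')(0 := Suc l)))) s''"
      using conjunct1[OF I] st i j l k(1) NW by (auto simp: set_sc_def less_Suc_eq split: if_splits)
  qed (use k N NW in \<open>auto simp: storedD\<close>)
  have "wp W max_label (\<lambda>m s'. m \<le> (71 * N + 21) * N \<and> ?I N 0 s') s"
    unfolding max_label_def
  proof (rule wp_FOR_const[where N = N and I = "\<lambda>k. ?I k 0"])
    fix k s'
    assume k: "k < N" and I: "?I k 0 s'" and i: "s' ''i'' 0 = k"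
      and fr: "\<And>y. y \<notin> insert ''i'' (written (FOR ''j'' ?c)) \<Longrightarrow> s' y = s y"
    have "stored s'" using st by (rule stored_cong) (simp_all add: fr)
    from row[OF k i this I]
    show "wp W (FOR ''j'' ?c) (\<lambda>m t. m \<le> 71 * N \<and> ?I (Suc k) 0 (t(''i'' := (t ''i'')(0 := Suc k)))) s'"
      by (rule wp_mono) (auto simp: less_Suc_eq)
  qed (use st mx N NW in \<open>auto simp: storedD\<close>)
  moreover have "(71 * N + 21) * N \<le> 100 * N * N"
    using N by (intro mult_le_mono1) simp
  ultimately show ?thesis
    by (elim wp_mono) (auto intro: le_trans)
qed

lemma wp_negate:
  assumes st: "stored s" and mx: "s ''mx'' 0 = mx" "mx \<le> L"
  shows "wp W negate (\<lambda>m s'. m \<le> 100 * N * N \<and>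
    (\<forall>i<N. \<forall>j<N. s' ''neg'' (pos N True i j) = mx - lam i j)) s"
proof -
  let ?c = "Assign ''neg'' (ix True (sc ''i'') (sc ''j'')) (Minus (sc ''mx'') (lab True (sc ''i'') (sc ''j'')))"
  let ?I = "\<lambda>k l s'. \<forall>i<N. \<forall>j<N. i < k \<or> i = k \<and> j < l \<longrightarrow> s' ''neg'' (pos N True i j) = mx - lam i j"
  have NW: "N < W" "L \<le> W" "0 < W" "N \<le> W" using W by auto
  have row: "wp W (FOR ''j'' ?c) (\<lambda>m s'. m \<le> (50 + 21) * N \<and> ?I k N s') s'"
    if k: "k < N" "s' ''i'' 0 = k" "s' ''mx'' 0 = mx" "stored s'" "?I k 0 s'" for s' k
  proof (rule wp_FOR_const[where N = N and I = "?I k"])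
    fix l s''
    assume l: "l < N" and I: "?I k l s''" and j: "s'' ''j'' 0 = l"
      and fr: "\<And>y. y \<notin> insert ''j'' (written ?c) \<Longrightarrow> s'' y = s' y"
    have st: "stored s''" using k(4) by (rule stored_cong) (simp_all add: fr)
    have i: "s'' ''i'' 0 = k" "s'' ''mx'' 0 = mx" using k(2,3) by (simp_all add: fr)
    show "wp W ?c (\<lambda>m t. m \<le> 50 \<and> ?I k (Suc l) (t(''j'' := (t ''j'')(0 := Suc l)))) s''"
      using I st i j l k(1) NW mx(2) by (simp add: storedD less_Suc_eq)
  qed (use k N NW in \<open>auto simp: storedD\<close>)
  have "wp W negate (\<lambda>m s'. m \<le> (71 * N + 21) * N \<and> ?I N 0 s') s"
    unfolding negate_def
  proof (rule wp_FOR_const[where N = N and I = "\<lambda>k. ?I k 0"])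
    fix k s'
    assume k: "k < N" and I: "?I k 0 s'" and i: "s' ''i'' 0 = k"
      and fr: "\<And>y. y \<notin> insert ''i'' (written (FOR ''j'' ?c)) \<Longrightarrow> s' y = s y"
    have "stored s'" using st by (rule stored_cong) (simp_all add: fr)
    moreover have "s' ''mx'' 0 = mx" using mx(1) by (simp add: fr)
    ultimately show "wp W (FOR ''j'' ?c) (\<lambda>m t. m \<le> 71 * N \<and> ?I (Suc k) 0 (t(''i'' := (t ''i'')(0 := Suc k)))) s'"
      by (rule wp_mono[OF row[OF k i _ _ I, rotated]]) (auto simp: less_Suc_eq)
  qed (use st N NW in \<open>auto simp: storedD\<close>)
  moreover have "(71 * N + 21) * N \<le> 100 * N * N"
    using N by (intro mult_le_mono1) simp
  ultimately show ?thesis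
    by (elim wp_mono) (auto intro: le_trans)
qed

definition chosen :: "state \<Rightarrow> (nat \<times> nat) set" where
  "chosen s = {(i, j). i < N \<and> j < N \<and> s ''out'' (i * N + j) \<noteq> 0}"

text \<open>Both halves are instances of \<open>round_context\<close> on one memory, and the edge
  and time budgets are followed by one loop invariant.\<close>

lemma wp_rounds:
  assumes st: "stored s" and mx: "s ''mx'' 0 = mx" "mx \<le> L"
    and lam_mx: "\<forall>i<N. \<forall>j<N. lam i j \<le> mx"
    and neg: "\<forall>i<N. \<forall>j<N. s ''neg'' (pos N True i j) = mx - lam i j"
    and zero: "\<forall>i<N. s ''row'' i = 0 \<and> s ''col'' i = 0" "chosen s = {}"
  shows "wp W (FOR ''k'' (Seq (round True) (round False))) (\<lambda>m s'. m \<le> 2500 * L * N ^ 3 \<and>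
    card (chosen s') \<le> 4 * L * N \<and> (\<forall>i<N. \<forall>j<N. reach lam (chosen s') i j)) s"
proof -
  have L: "0 < L" using lam[OF N N] by simp
  have mx0: "0 < mx" using lam[OF N N] lam_mx N by force
  interpret T: round_context W N mx L lam True
  proof
    show "N * N + N + mx + 5 \<le> W" using W mx by simp
    show "lam i h < lam i h' + L" if "i < N" "h < N" "h' < N" for i h h'
      using lam[OF that(1,2)] lam[OF that(1,3)] by simp
  qed (use N lam_mx in auto)
  \<comment> \<open>Complemented labels lie between 0 and \<open>mx - 1\<close> with
    \<open>mx \<le> L\<close>, hence again differ by less than \<open>L\<close>.\<close>
  interpret F: round_context W N mx L "\<lambda>j i. mx - lam i j" False
  proof
    show "N * N + N + mx + 5 \<le> W" using W mx by simp
    show "mx - lam h i < mx - lam h' i + L" if "i < N" "h < N" "h' < N" for i h h'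
      using lam[OF that(2,1)] mx mx0 by linarith
  qed (use N in auto)
  have swap: "F.rows t = T.cols t" "F.cols t = T.rows t" "F.edges t = (T.edges t)\<inverse>" for t
    by (auto simp: F.rows_def T.cols_def F.cols_def T.rows_def F.edges_def T.edges_def pos_def)
  have chosen: "chosen t = T.edges t" for t
    by (simp add: chosen_def T.edges_def pos_def)
  have le: "(i, j) \<in> T.edges t \<Longrightarrow> lam i j \<le> mx" for i j t
    using lam_mx by (simp add: T.edges_def)
  \<comment> \<open>Time potential: each live vertex holds \<open>L\<close> units of
    \<open>600 * N * N\<close>. The term \<open>2 * k\<close> in the invariant pays for the additive
    1 in the cost of each of the two rounds of an iteration.\<close>
  let ?pot = "\<lambda>R Q. 600 * N * N * L * (card R + card Q)"
  let ?I = "\<lambda>k t s'. T.good s' \<and> F.good s' \<and> cover_inv N L lam (T.rows s') (T.cols s') (T.edges s') \<and>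
    card (T.rows s') \<le> N - k \<and> t + ?pot (T.rows s') (T.cols s') \<le> 600 * N * N * (2 * L * N + 2 * k)"
  have upd_k: "T.good (t(''k'' := f)) \<longleftrightarrow> T.good t" "F.good (t(''k'' := f)) \<longleftrightarrow> F.good t"
    "T.rows (t(''k'' := f)) = T.rows t" "T.cols (t(''k'' := f)) = T.cols t" "T.edges (t(''k'' := f)) = T.edges t"
    for t f
    by (simp_all add: T.rows_def T.cols_def T.edges_def)
  have step: "wp W (Seq (round True) (round False)) (\<lambda>m t'. ?I (Suc k) (t + m) t') s0"
    if I: "?I k t s0" and k: "k < N" for k t s0
    unfolding wp_Seq
  proof (rule wp_frame[OF T.wp_round])
    show "T.good s0" using I by simp
    fix m1 s1
    assume 1: "m1 \<le> 600 * N * N * (card (T.rows s0) + 1) \<and> T.good s1 \<and>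
        round_step N L lam (T.rows s0) (T.cols s0) (T.edges s0) (T.rows s1) (T.edges s1)"
      and f1: "\<And>y. y \<notin> written (round True) \<Longrightarrow> s1 y = s0 y"
    have "s1 (lb False) = s0 (lb False)" "s1 ''n'' = s0 ''n''" "s1 ''mx'' = s0 ''mx''"
      by (simp_all add: f1)
    then have g1: "F.good s1"
      using conjunct1[OF conjunct2[OF I]] conjunct1[OF conjunct2[OF 1]]
      by (simp add: F.good_def T.good_def del: T.goodD F.goodD)
    have c1: "T.cols s1 = T.cols s0" using f1[of "rr False"] by (simp add: T.cols_def rr_def)
    show "wp W (round False) (\<lambda>m2 t'. ?I (Suc k) (t + (m1 + m2)) t') s1"
    proof (rule wp_frame[OF F.wp_round[OF g1]])
      fix m2 s2
      assume 2: "m2 \<le> 600 * N * N * (card (F.rows s1) + 1) \<and> F.good s2 \<and>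
          round_step N L (\<lambda>j i. mx - lam i j) (F.rows s1) (F.cols s1) (F.edges s1) (F.rows s2) (F.edges s2)"
        and f2: "\<And>y. y \<notin> written (round False) \<Longrightarrow> s2 y = s1 y"
      have "s2 (lb True) = s1 (lb True)" "s2 ''n'' = s1 ''n''" "s2 ''mx'' = s1 ''mx''"
        by (simp_all add: f2)
      then have g2: "T.good s2"
        using conjunct1[OF conjunct2[OF 1]] conjunct1[OF conjunct2[OF 2]]
        by (simp add: F.good_def T.good_def del: T.goodD F.goodD)
      have r2: "T.rows s2 = T.rows s1" using f2[of "rr True"] by (simp add: T.rows_def rr_def)
      have 3: "round_step N L lam (T.rows s0) (T.cols s0) (T.edges s0) (T.rows s2) (T.edges s1)"
        using 1 r2 by simp
      have 4: "round_step N L (\<lambda>j i. mx - lam i j) (T.cols s0) (T.rows s2) ((T.edges s1)\<inverse>) (T.cols s2) ((T.edges s2)\<inverse>)"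
        using 2 r2 c1 by (simp add: swap)
      have inv: "cover_inv N L lam (T.rows s2) (T.cols s2) (T.edges s2)"
        by (rule cover_inv_step[OF _ 3 4]) (use I le in auto)
      have rem: "card (T.rows s0) + L * card (T.rows s2) \<le> L * card (T.rows s0)"
        "card (T.cols s0) + L * card (T.cols s2) \<le> L * card (T.cols s0)"
        by (rule round_step_removed(1)[OF 3], simp, rule round_step_removed(1)[OF 4], simp)
      \<comment> \<open>As long as a source is alive, the first round kills at least one.\<close>
      have "card (T.rows s2) \<le> N - Suc k"
      proof (cases "T.rows s0 = {}")
        case True
        then have "T.rows s2 = {}" using round_step_subset[OF 3] by auto
        then show ?thesis by simp
      next
        case False
        then have "card (T.rows s2) < card (T.rows s0)" using round_step_removed(2)[OF 3] by simp
        moreover have "card (T.rows s0) \<le> N - k" using I by blast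
        ultimately show ?thesis by linarith
      qed
      moreover have "t + (m1 + m2) + ?pot (T.rows s2) (T.cols s2) \<le> 600 * N * N * (2 * L * N + 2 * Suc k)"
      proof -
        let ?K = "600 * N * N"
        have "t + (m1 + m2) + ?pot (T.rows s2) (T.cols s2) \<le>
            t + ?K * (card (T.rows s0) + L * card (T.rows s2)) + ?K * (card (T.cols s0) + L * card (T.cols s2)) + ?K * 2"
          using 1 2 c1 by (simp add: swap algebra_simps)
        also have "\<dots> \<le> t + ?K * (L * card (T.rows s0)) + ?K * (L * card (T.cols s0)) + ?K * 2"
          by (intro add_mono mult_le_mono2 rem order_refl)
        also have "\<dots> = t + ?pot (T.rows s0) (T.cols s0) + ?K * 2" by (simp add: algebra_simps)
        also have "\<dots> \<le> ?K * (2 * L * N + 2 * k) + ?K * 2" using I by (intro add_mono) auto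
        also have "\<dots> = ?K * (2 * L * N + 2 * Suc k)" by (simp add: algebra_simps)
        finally show ?thesis .
      qed
      ultimately show "?I (Suc k) (t + (m1 + m2)) s2"
        using g2 inv 2 by simp
    qed
  qed
  have init: "?I 0 0 s"
  proof -
    have gT: "T.good s"
      using st mx zero by (simp add: T.good_def stored_def lb_def rr_def del: T.goodD F.goodD)
    have "pos N False i j = pos N True j i" for i j by (simp add: pos_def)
    then have gF: "F.good s"
      using st mx zero neg by (simp add: F.good_def stored_def lb_def rr_def del: T.goodD F.goodD)
    have "T.rows s = {..<N}" "T.cols s = {..<N}"
      using zero by (auto simp: T.rows_def T.cols_def rr_def)
    then show ?thesis
      using gT gF zero(2) by (simp add: cover_inv_def chosen)
  qed
  show ?thesis
  proof (rule wp_FOR[where N = N and I = ?I])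
    show "s ''n'' 0 = N" using st by (rule storedD)
    show "N < W" using W by simp
    show "''k'' \<notin> written (Seq (round True) (round False))" "''n'' \<notin> written (Seq (round True) (round False))"
      by (simp_all add: rr_def)
    show "?I 0 0 (s(''k'' := (s ''k'')(0 := 0)))" using init by (simp add: upd_k)
  next
    fix k t s'
    assume "k < N" "?I k t s'"
    then have "wp W (Seq (round True) (round False)) (\<lambda>m t'. ?I (Suc k) (t + m) t') s'"
      by (intro step)
    then show "wp W (Seq (round True) (round False))
        (\<lambda>m t'. ?I (Suc k) (t + m) (t'(''k'' := (t' ''k'')(0 := Suc k)))) s'"
      by (rule wp_mono) (simp add: upd_k)
  next
    fix t s'
    assume I: "?I N t s'"
    have "t + 12 * N + 9 \<le> 1200 * (L * N ^ 3) + 1200 * N ^ 3 + 21 * N"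
      using I N by (simp add: algebra_simps power3_eq_cube)
    moreover have "N ^ 3 \<le> L * N ^ 3" using L by simp
    moreover have "N \<le> N ^ 3" using N by (intro self_le_power) auto
    ultimately have "t + 12 * N + 9 \<le> 2500 * L * N ^ 3" by linarith
    \<comment> \<open>After \<open>N\<close> iterations no source is alive, so
      \<open>cover_inv\<close> settles all pairs, whatever columns remain.\<close>
    moreover have "T.rows s' = {}" using I by simp
    ultimately show "t + 12 * N + 9 \<le> 2500 * L * N ^ 3 \<and> card (chosen s') \<le> 4 * L * N \<and>
        (\<forall>i<N. \<forall>j<N. reach lam (chosen s') i j)"
      using I by (simp add: cover_inv_def chosen)
  qed simp
qed

lemma wp_bispanner_prog:
  assumes st: "stored s" and zero: "\<And>x k. x \<noteq> ''n'' \<Longrightarrow> x \<noteq> ''lab'' \<Longrightarrow> s x k = 0"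
  shows "wp W bispanner_prog (\<lambda>m s'. m \<le> 2700 * (L * N ^ 3) \<and>
    card (chosen s') \<le> 4 * L * N \<and> (\<forall>i<N. \<forall>j<N. reach lam (chosen s') i j)) s"
  unfolding bispanner_prog_def wp_Seq
proof (rule wp_frame[OF wp_max_label[OF st]])
  show "s ''mx'' 0 = 0" by (simp add: zero)
  fix m1 s1
  assume 1: "m1 \<le> 100 * N * N \<and> s1 ''mx'' 0 \<le> L \<and> (\<forall>i<N. \<forall>j<N. lam i j \<le> s1 ''mx'' 0)"
    and f1: "\<And>y. y \<notin> written max_label \<Longrightarrow> s1 y = s y"
  have w1: "written max_label = {''i'', ''j'', ''mx''}" by (simp add: max_label_def)
  have st1: "stored s1" using st by (rule stored_cong) (simp_all add: f1 w1)
  show "wp W negate (\<lambda>m2. wp W (FOR ''k'' (Seq (round True) (round False))) (\<lambda>m3 s'.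
      m1 + (m2 + m3) \<le> 2700 * (L * N ^ 3) \<and> card (chosen s') \<le> 4 * L * N \<and>
      (\<forall>i<N. \<forall>j<N. reach lam (chosen s') i j))) s1"
  proof (rule wp_frame[OF wp_negate[OF st1 refl]])
    show "s1 ''mx'' 0 \<le> L" using 1 by simp
    fix m2 s2
    assume 2: "m2 \<le> 100 * N * N \<and> (\<forall>i<N. \<forall>j<N. s2 ''neg'' (pos N True i j) = s1 ''mx'' 0 - lam i j)"
      and f2: "\<And>y. y \<notin> written negate \<Longrightarrow> s2 y = s1 y"
    have w2: "written negate = {''i'', ''j'', ''neg''}" by (simp add: negate_def)
    have st2: "stored s2" using st1 by (rule stored_cong) (simp_all add: f2 w2)
    have z: "\<forall>i<N. s2 ''row'' i = 0 \<and> s2 ''col'' i = 0" "chosen s2 = {}"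
      by (simp_all add: chosen_def f1 f2 w1 w2 zero)
    have mx2: "s2 ''mx'' 0 = s1 ''mx'' 0" by (simp add: f2 w2)
    show "wp W (FOR ''k'' (Seq (round True) (round False))) (\<lambda>m3 s'.
      m1 + (m2 + m3) \<le> 2700 * (L * N ^ 3) \<and> card (chosen s') \<le> 4 * L * N \<and>
      (\<forall>i<N. \<forall>j<N. reach lam (chosen s') i j)) s2"
    proof (rule wp_mono[OF wp_rounds[OF st2 mx2 _ _ _ z]])
      fix m3 s3
      assume 3: "m3 \<le> 2500 * L * N ^ 3 \<and> card (chosen s3) \<le> 4 * L * N \<and>
        (\<forall>i<N. \<forall>j<N. reach lam (chosen s3) i j)"
      have "0 < L" using lam[OF N N] by simp
      \<comment> \<open>This lets the 200 units per matrix entry spent on preprocessing be added to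
        the 2500.\<close>
      then have "N * N \<le> L * N ^ 3" using N by (simp add: power3_eq_cube)
      then have "m1 + (m2 + m3) \<le> 2700 * (L * N ^ 3)" using 1 2 3 by linarith
      then show "m1 + (m2 + m3) \<le> 2700 * (L * N ^ 3) \<and> card (chosen s3) \<le> 4 * L * N \<and>
        (\<forall>i<N. \<forall>j<N. reach lam (chosen s3) i j)" using 3 by simp
    qed (use 1 2 in auto)
  qed
qed

end

section \<open>From index matrices back to temporal bispanners\<close>

text \<open>If \<open>(i, j)\<close> is an edge, it is a one-hop path. Otherwise the walk through
  the hub is not degenerate, and its four vertices are distinct as a path requires.\<close>

lemma reach_temporal_path:
  assumes r: "reach (\<lambda>i j. f {us ! i, ts ! j}) E i j" and E: "E \<subseteq> {..<length us} \<times> {..<length ts}"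
    and d: "distinct us" "distinct ts" "set us \<inter> set ts = {}"
  shows "\<exists>p. temporal_path f ((\<lambda>(i, j). {us ! i, ts ! j}) ` E) (us ! i) p (ts ! j) \<and> hops p \<le> 3"
proof -
  let ?E = "(\<lambda>(i, j). {us ! i, ts ! j}) ` E"
  obtain h w where e: "(i, h) \<in> E" "(w, h) \<in> E" "(w, j) \<in> E"
    and f: "f {us ! i, ts ! h} \<le> f {us ! w, ts ! h}" "f {us ! w, ts ! h} \<le> f {us ! w, ts ! j}"
    using r unfolding reach_def by blast
  have len: "i < length us" "w < length us" "h < length ts" "j < length ts" using e E by auto
  have ne: "us ! a \<noteq> ts ! c" "ts ! c \<noteq> us ! a" if "a < length us" "c < length ts" for a c
    using d(3) that by (metis disjoint_iff nth_mem)+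
  have in_E: "{us ! a, ts ! c} \<in> ?E" if "(a, c) \<in> E" for a c using that by force
  show ?thesis
  proof (cases "(i, j) \<in> E")
    case True
    then show ?thesis
      using len ne in_E by (intro exI[of _ "[us ! i, ts ! j]"]) (simp add: temporal_path_def hops_def)
  next
    case False
    then have "w \<noteq> i" "h \<noteq> j" using e by auto
    then have neq: "us ! i \<noteq> us ! w" "ts ! h \<noteq> ts ! j"
      using d len by (simp_all add: nth_eq_iff_index_eq)
    have c: "{ts ! h, us ! w} = {us ! w, ts ! h}" by auto
    show ?thesis
      using len ne neq in_E e f
      by (intro exI[of _ "[us ! i, ts ! h, us ! w, ts ! j]"]) (simp add: temporal_path_def hops_def c)
  qed
qed

text \<open>The word bound is polynomial in \<open>n + L\<close>, so words have logarithmically many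
  bits; \<open>5 * (n + L) ^ 2\<close> dominates the bound required by \<open>labels\<close>. The
  edge count obtained, \<open>4 * L * n\<close>, is within the claimed one.\<close>

lemma bispanner_prog_correct:
  fixes S :: "'a set"
  assumes n: "0 < n" and bi: "temporal_biclique S T f" and bal: "balanced_of_size S T n"
    and lt: "lifetime_at_most S T f L"
    and us: "distinct us" "set us = S" and ts: "distinct ts" "set ts = T"
  shows "\<exists>m s'. exec (5 * (n + L) ^ 2) bispanner_prog (input_state f us ts) m s' \<and>
    m \<le> 2700 * (L * n ^ 3) \<and> temporal_bispanner S T f 3 (output_edges us ts s') \<and>
    card (output_edges us ts s') \<le> 12 * L * n"
proof -
  let ?lam = "\<lambda>i j. f {us ! i, ts ! j}"
  have len: "length us = n" "length ts = n"
    using bal us ts by (metis balanced_of_size_def distinct_card)+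
  have edge: "{us ! i, ts ! j} \<in> biclique_edges S T" if "i < n" "j < n" for i j
  proof -
    have "us ! i \<in> S" "ts ! j \<in> T" using that len us ts by auto
    then show ?thesis unfolding biclique_edges_def by blast
  qed
  have lam: "1 \<le> ?lam i j \<and> ?lam i j \<le> L" if "i < n" "j < n" for i j
    using edge[OF that] lt unfolding lifetime_at_most_def by auto
  have "0 < L" using lam[OF n n] by simp
  interpret labels "5 * (n + L) ^ 2" n L ?lam
  proof
    have sq: "(n + L) ^ 2 = n * n + 2 * (n * L) + L * L" by (simp add: power2_eq_square algebra_simps)
    have "a + n + L + 5 \<le> 5 * (a + 2 * b + c)" if "n \<le> a" "L \<le> c" "1 \<le> b" for a b c
      using that by (simp add: algebra_simps)
    from this[of "n * n" "L * L" "n * L"] show "n * n + n + L + 5 \<le> 5 * (n + L) ^ 2"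
      unfolding sq using n \<open>0 < L\<close> by simp
  qed (use n lam in auto)
  have st: "stored (input_state f us ts)"
    unfolding stored_def
  proof (intro conjI allI impI)
    fix i j assume ij: "i < n" "j < n"
    then have "pos n True i j < n * n" by (rule pos_less)
    then show "input_state f us ts ''lab'' (pos n True i j) = ?lam i j"
      using ij by (simp add: input_state_def len pos_def)
  qed (simp add: input_state_def len)
  obtain m s' where run: "exec (5 * (n + L) ^ 2) bispanner_prog (input_state f us ts) m s'"
    "m \<le> 2700 * (L * n ^ 3)" "card (chosen s') \<le> 4 * L * n" "\<forall>i<n. \<forall>j<n. reach ?lam (chosen s') i j"
    using wp_bispanner_prog[OF st] unfolding wp_def by (auto simp: input_state_def)
  have out: "output_edges us ts s' = (\<lambda>(i, j). {us ! i, ts ! j}) ` chosen s'"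
    unfolding output_edges_def chosen_def len by auto
  have fin: "chosen s' \<subseteq> {..<n} \<times> {..<n}" by (auto simp: chosen_def)
  have "card (output_edges us ts s') \<le> card (chosen s')"
    unfolding out by (rule card_image_le) (use fin finite_subset in blast)
  then have card: "card (output_edges us ts s') \<le> 12 * L * n" using run(3) by simp
  have "temporal_bispanner S T f 3 (output_edges us ts s')"
    unfolding temporal_bispanner_def
  proof (intro conjI ballI)
    show "output_edges us ts s' \<subseteq> biclique_edges S T"
      using edge len unfolding output_edges_def by auto
    fix x y assume "x \<in> S" "y \<in> T"
    then obtain i j where ij: "i < n" "j < n" "x = us ! i" "y = ts ! j"
      using us ts len by (metis in_set_conv_nth)
    then show "\<exists>p. temporal_path f (output_edges us ts s') x p y \<and> hops p \<le> 3"
      using reach_temporal_path[of f us ts "chosen s'" i j] run(4) fin us ts bi len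
      unfolding out temporal_biclique_def by simp
  qed
  then show ?thesis using run card by blast
qed

theorem theorem12:
  "(\<forall>n L (S :: 'a set) T lam.
      0 < n \<longrightarrow> 0 < L \<longrightarrow> temporal_biclique S T lam \<longrightarrow> balanced_of_size S T n \<longrightarrow>
      lifetime_at_most S T lam L \<longrightarrow>
      (\<exists>E'. temporal_bispanner S T lam 3 E' \<and> card E' \<le> 12 * L * n)) \<and>
   (\<exists>prog C d k. \<forall>n L (S :: 'a set) T lam us ts.
      0 < n \<longrightarrow> 0 < L \<longrightarrow> temporal_biclique S T lam \<longrightarrow> balanced_of_size S T n \<longrightarrow>
      lifetime_at_most S T lam L \<longrightarrow>
      distinct us \<longrightarrow> set us = S \<longrightarrow> distinct ts \<longrightarrow> set ts = T \<longrightarrow>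
      (\<exists>m s'. exec (d * (n + L) ^ k) prog (input_state lam us ts) m s' \<and>
         m \<le> C * (L * n ^ 3) \<and>
         temporal_bispanner S T lam 3 (output_edges us ts s') \<and>
         card (output_edges us ts s') \<le> 12 * L * n))"
proof (rule conjI)
  show "\<exists>prog C d k. \<forall>n L (S :: 'a set) T lam us ts.
      0 < n \<longrightarrow> 0 < L \<longrightarrow> temporal_biclique S T lam \<longrightarrow> balanced_of_size S T n \<longrightarrow>
      lifetime_at_most S T lam L \<longrightarrow>
      distinct us \<longrightarrow> set us = S \<longrightarrow> distinct ts \<longrightarrow> set ts = T \<longrightarrow>
      (\<exists>m s'. exec (d * (n + L) ^ k) prog (input_state lam us ts) m s' \<and>
         m \<le> C * (L * n ^ 3) \<and>
         temporal_bispanner S T lam 3 (output_edges us ts s') \<and>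
         card (output_edges us ts s') \<le> 12 * L * n)"
    by (intro exI[of _ bispanner_prog] exI[of _ 2700] exI[of _ 5] exI[of _ 2] allI impI
        bispanner_prog_correct)
  show "\<forall>n L (S :: 'a set) T lam.
      0 < n \<longrightarrow> 0 < L \<longrightarrow> temporal_biclique S T lam \<longrightarrow> balanced_of_size S T n \<longrightarrow>
      lifetime_at_most S T lam L \<longrightarrow>
      (\<exists>E'. temporal_bispanner S T lam 3 E' \<and> card E' \<le> 12 * L * n)"
  proof (intro allI impI)
    fix n L :: nat and S T :: "'a set" and lam
    assume *: "0 < n" "temporal_biclique S T lam" "balanced_of_size S T n" "lifetime_at_most S T lam L"
    \<comment> \<open>Existence of a small bispanner follows by running the program on arbitrary
      enumerations of the two sides.\<close>
    then obtain us ts where "distinct us" "set us = S" "distinct ts" "set ts = T"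
      using finite_distinct_list unfolding temporal_biclique_def by metis
    from bispanner_prog_correct[OF * this]
    show "\<exists>E'. temporal_bispanner S T lam 3 E' \<and> card E' \<le> 12 * L * n" by blast
  qed
qed

end
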